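(* The quantified propositional Gödel logic $\mathbf{G}^{\mathrm{qp}}_{\uparrow}$, i.e. the set of all quantified propositional formulas that are tautologies over the truth-value set $V_\uparrow=\{1-1/n : n\ge 1\}\cup\{1\}$, is decidable.
   Context: Formulas are built from a countably infinite set $\mathrm{Var}$ of propositional variables and the constants $\bot,\top$ using the binary connectives $\land,\lor,\supset$, the unary connective $\circ$, and the propositional quantifiers $(\forall p)$, $(\exists p)$ for $p\in\mathrm{Var}$. Let $V\subseteq[0,1]$ contain $0,1$ and be closed under infima and suprema. A valuation is a map $v:\mathrm{Var}\to V$; $v[w/p]$ is the valuation that agrees with $v$ except that it maps $p$ to $w$. Valuations extend to formulas by: $v(\bot)=0$, $v(\top)=1$, $v(A\land B)=\min(v(A),v(B))$, $v(A\lor B)=\max(v(A),v(B))$, $v(A\supset B)=1$ if $v(A)\le v(B)$ and $=v(B)$ otherwise, $v((\exists p)A)=\sup\{v[w/p](A):w\in V\}$, $v((\forall p)A)=\inf\{v[w/p](A):w\in V\}$, and $v(\circ A)=v((\forall p)((p\supset A)\lor p))$ with $p$ not free in $A$. (Over $V_\uparrow$: $v(\circ A)=1$ if $v(A)=1$, and $v(\circ A)=1-\frac1{n+1}$ if $v(A)=1-\frac1n$.) A formula $A$ is a tautology over $V$ if $v(A)=1$ for every valuation $v$ into $V$. *)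

theory Defs
  imports Complex_Main "HOL-Library.Nat_Bijection"
begin

datatype form =
    PVar nat
  | Bot
  | Top
  | And form form
  | Or form form
  | Imp form form
  | Circ form
  | Forall nat form
  | Exists nat form

fun fv :: "form \<Rightarrow> nat set" where
  "fv (PVar p) = {p}"
| "fv Bot = {}"
| "fv Top = {}"
| "fv (And A B) = fv A \<union> fv B"
| "fv (Or A B) = fv A \<union> fv B"
| "fv (Imp A B) = fv A \<union> fv B"
| "fv (Circ A) = fv A"
| "fv (Forall p A) = fv A - {p}"
| "fv (Exists p A) = fv A - {p}"

definition imp_val :: "real \<Rightarrow> real \<Rightarrow> real" where
  "imp_val a b = (if a \<le> b then 1 else b)"

text \<open>The set \<open>V\<close> of truth values is meant to be a subset of \<open>[0,1]\<close> that contains 0 and 1 and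
  is closed under suprema and infima; the suprema and infima below are then those of nonempty
  bounded sets.  The clause for \<open>Circ\<close> is the value of \<open>(\<forall>p)((p \<supset> A) \<or> p)\<close>, where \<open>p\<close> does not
  occur free in \<open>A\<close>; see \<open>eval_Circ\<close>.\<close>

fun eval :: "real set \<Rightarrow> (nat \<Rightarrow> real) \<Rightarrow> form \<Rightarrow> real" where
  "eval V v (PVar p) = v p"
| "eval V v Bot = 0"
| "eval V v Top = 1"
| "eval V v (And A B) = min (eval V v A) (eval V v B)"
| "eval V v (Or A B) = max (eval V v A) (eval V v B)"
| "eval V v (Imp A B) = imp_val (eval V v A) (eval V v B)"
| "eval V v (Circ A) = (INF w\<in>V. max (imp_val w (eval V v A)) w)"
| "eval V v (Forall p A) = (INF w\<in>V. eval V (v(p := w)) A)"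
| "eval V v (Exists p A) = (SUP w\<in>V. eval V (v(p := w)) A)"

lemma eval_cong_fv: "(\<And>p. p \<in> fv A \<Longrightarrow> v p = v' p) \<Longrightarrow> eval V v A = eval V v' A"
proof (induction A arbitrary: v v')
  case (And A B)
  have "eval V v A = eval V v' A" using And.prems by (intro And.IH(1)) simp
  moreover have "eval V v B = eval V v' B" using And.prems by (intro And.IH(2)) simp
  ultimately show ?case by simp
next
  case (Or A B)
  have "eval V v A = eval V v' A" using Or.prems by (intro Or.IH(1)) simp
  moreover have "eval V v B = eval V v' B" using Or.prems by (intro Or.IH(2)) simp
  ultimately show ?case by simp
next
  case (Imp A B)
  have "eval V v A = eval V v' A" using Imp.prems by (intro Imp.IH(1)) simp
  moreover have "eval V v B = eval V v' B" using Imp.prems by (intro Imp.IH(2)) simp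
  ultimately show ?case by simp
next
  case (Circ A)
  have "eval V v A = eval V v' A" using Circ.prems by (intro Circ.IH) simp
  then show ?case by simp
next
  case (Forall p A)
  have "eval V (v(p := w)) A = eval V (v'(p := w)) A" for w
    using Forall.prems by (intro Forall.IH) simp
  then show ?case by simp
next
  case (Exists p A)
  have "eval V (v(p := w)) A = eval V (v'(p := w)) A" for w
    using Exists.prems by (intro Exists.IH) simp
  then show ?case by simp
qed simp_all

lemma eval_Circ:
  assumes "p \<notin> fv A"
  shows "eval V v (Circ A) = eval V v (Forall p (Or (Imp (PVar p) A) (PVar p)))"
proof -
  have "eval V (v(p := w)) A = eval V v A" for w
  proof (rule eval_cong_fv)
    fix q assume "q \<in> fv A"
    then have "q \<noteq> p" using assms by blast
    then show "(v(p := w)) q = v q" by (rule fun_upd_other)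
  qed
  then show ?thesis by (simp only: eval.simps fun_upd_same)
qed

definition tautology :: "real set \<Rightarrow> form \<Rightarrow> bool" where
  "tautology V A \<longleftrightarrow> (\<forall>v. (\<forall>p. v p \<in> V) \<longrightarrow> eval V v A = 1)"

definition V_up :: "real set" where
  "V_up = {1 - 1 / real n | n. n \<ge> 1} \<union> {1}"

definition G_qp_up :: "form set" where
  "G_qp_up = {A. tautology V_up A}"

lemma V_up_le_one: "w \<in> V_up \<Longrightarrow> w \<le> 1"
  unfolding V_up_def by fastforce

lemma eval_Circ_V_up_one:
  assumes "eval V_up v A = 1"
  shows "eval V_up v (Circ A) = 1"
proof -
  have "max (imp_val w 1) w = 1" if "w \<in> V_up" for w
    using V_up_le_one[OF that] by (simp add: imp_val_def)
  then have "(\<lambda>w. max (imp_val w 1) w) ` V_up = (\<lambda>_. 1) ` V_up"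
    by (rule image_cong[OF refl])
  also have "\<dots> = {1}" unfolding V_up_def by blast
  finally have "(INF w\<in>V_up. max (imp_val w 1) w) = Inf {1}" by (rule arg_cong)
  then show ?thesis by (simp only: eval.simps assms cInf_singleton)
qed

lemma eval_Circ_V_up_less_one:
  assumes "n \<ge> 1" "eval V_up v A = 1 - 1 / real n"
  shows "eval V_up v (Circ A) = 1 - 1 / (real n + 1)"
proof -
  define a where "a = 1 - 1 / real n"
  define b where "b = 1 - 1 / (real n + 1)"
  have ab: "a < b"
    unfolding a_def b_def using assms(1) by (simp add: frac_less2)
  have "b = 1 - 1 / real (Suc n) \<and> 1 \<le> Suc n" by (simp add: b_def add.commute)
  then have bV: "b \<in> V_up" unfolding V_up_def by (intro UnI1 CollectI exI)
  have b1: "b \<le> 1" using bV by (rule V_up_le_one)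
  have lower: "b \<le> max (imp_val w a) w" if w: "w \<in> V_up" for w
  proof (cases "w \<le> a")
    case True
    then show ?thesis using b1 by (simp add: imp_val_def)
  next
    case False
    consider "w = 1" | m where "m \<ge> 1" "w = 1 - 1 / real m"
      using w unfolding V_up_def by blast
    then have "b \<le> w"
    proof cases
      case 1
      then show ?thesis using b1 by simp
    next
      case (2 m)
      have lt: "1 / real m < 1 / real n" using False 2(2) unfolding a_def by linarith
      have "n < m"
      proof (rule ccontr)
        assume "\<not> n < m"
        then have "real m \<le> real n" by simp
        then have "1 / real n \<le> 1 / real m" using 2(1) by (intro divide_left_mono) auto
        with lt show False by linarith
      qed
      then have "real n + 1 \<le> real m" by linarith
      then have "1 / real m \<le> 1 / (real n + 1)"
        by (intro divide_left_mono) auto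
      then show ?thesis unfolding b_def 2(2) by linarith
    qed
    then show ?thesis by linarith
  qed
  have "b = max (imp_val b a) b" using ab by (simp add: imp_val_def)
  then have "b \<in> (\<lambda>w. max (imp_val w a) w) ` V_up" by (rule image_eqI[OF _ bV])
  then have "(INF w\<in>V_up. max (imp_val w a) w) = b"
  proof (rule cInf_eq_minimum)
    fix x assume "x \<in> (\<lambda>w. max (imp_val w a) w) ` V_up"
    then show "b \<le> x" using lower by (elim imageE) simp
  qed
  then show ?thesis unfolding a_def b_def by (simp only: eval.simps assms(2))
qed

text \<open>\<open>recfn n f\<close>: restricted to lists of length \<open>n\<close>, \<open>f\<close> is a total recursive function of
  \<open>n\<close> arguments, i.e. it is obtained from the basic functions by composition, primitive recursion,
  and minimization of regular functions.  Values on lists of other lengths are irrelevant: each rule,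
  on lists of the right length, applies its arguments only to lists of the right length.\<close>

inductive recfn :: "nat \<Rightarrow> (nat list \<Rightarrow> nat) \<Rightarrow> bool" where
  zero: "recfn n (\<lambda>_. 0)"
| succ: "recfn 1 (\<lambda>xs. Suc (xs ! 0))"
| proj: "i < n \<Longrightarrow> recfn n (\<lambda>xs. xs ! i)"
| comp: "recfn (length gs) f \<Longrightarrow> (\<And>g. g \<in> set gs \<Longrightarrow> recfn n g) \<Longrightarrow>
    recfn n (\<lambda>xs. f (map (\<lambda>g. g xs) gs))"
| prec: "recfn n f \<Longrightarrow> recfn (n + 2) g \<Longrightarrow>
    recfn (n + 1) (\<lambda>xs. rec_nat (f (tl xs)) (\<lambda>y r. g (y # r # tl xs)) (hd xs))"
| mu: "recfn (n + 1) f \<Longrightarrow> (\<And>xs. length xs = n \<Longrightarrow> \<exists>y. f (y # xs) = 0) \<Longrightarrow>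
    recfn n (\<lambda>xs. LEAST y. f (y # xs) = 0)"

definition recursive_set :: "nat set \<Rightarrow> bool" where
  "recursive_set S \<longleftrightarrow> (\<exists>f. recfn 1 f \<and> (\<forall>x. f [x] = (if x \<in> S then 1 else 0)))"

text \<open>A Goedel numbering based on the Cantor pairing function.\<close>

fun code :: "form \<Rightarrow> nat" where
  "code (PVar p) = prod_encode (0, p)"
| "code Bot = prod_encode (1, 0)"
| "code Top = prod_encode (2, 0)"
| "code (And A B) = prod_encode (3, prod_encode (code A, code B))"
| "code (Or A B) = prod_encode (4, prod_encode (code A, code B))"
| "code (Imp A B) = prod_encode (5, prod_encode (code A, code B))"
| "code (Circ A) = prod_encode (6, code A)"
| "code (Forall p A) = prod_encode (7, prod_encode (p, code A))"
| "code (Exists p A) = prod_encode (8, prod_encode (p, code A))"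

lemma code_inject: "code A = code B \<longleftrightarrow> A = B"
proof (induction A arbitrary: B)
  case (PVar p) then show ?case by (cases B) auto
next
  case Bot then show ?case by (cases B) auto
next
  case Top then show ?case by (cases B) auto
next
  case (And A1 A2) then show ?case by (cases B) auto
next
  case (Or A1 A2) then show ?case by (cases B) auto
next
  case (Imp A1 A2) then show ?case by (cases B) auto
next
  case (Circ A) then show ?case by (cases B) auto
next
  case (Forall p A) then show ?case by (cases B) auto
next
  case (Exists p A) then show ?case by (cases B) auto
qed

definition decidable :: "form set \<Rightarrow> bool" where
  "decidable S \<longleftrightarrow> recursive_set (code ` S)"

end

theory Submission imports Defs begin

text \<open>Identifying all truth values from the \<open>N\<close>-th one on is a congruence for all connectives and
  quantifiers (for the quantifiers because suprema and infima in \<open>V_up\<close> are detected by strict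
  comparison with isolated points).  So a formula is a tautology over \<open>V_up\<close> iff it is valid in
  (cofinally many of) the finite chains \<open>{0..N}\<close> with truncated successor as \<open>\<circ>\<close>.  A formula speaks
  about such a chain like a first-order formula, so by a back-and-forth argument as for
  Ehrenfeucht-Fraisse games on linear orders, validity does not depend on \<open>N\<close> once \<open>N\<close> is
  exponential in the rank.  Validity in one chain, whose size is computed from the code of the
  formula, is decided by a primitive recursive truth table.\<close>

subsection \<open>Finite chains\<close>

text \<open>The value 1 is the limit of the others, so no single truncation separates it from all of
  them: a value is 1 exactly when its truncation is the top for all large \<open>N\<close>. Thus
  \<open>V_up\<close> yields a condition on infinitely many chains, and only independence of
  \<open>N\<close> makes it finite. A formula denotes an element of the chain, not just a truth
  value, so two chains are compared through a relation between elements to which the values of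
  subformulas are added. As \<circ> sees the successor, order alone is not enough: distances must
  agree up to a cap, and each newly matched element halves the cap. The recursive part has no
  recursion over formulas; it recurses over codes, so the table has a row for every number up to the
  given code, whether it codes a formula or not.\<close>

fun evf :: "nat \<Rightarrow> (nat \<Rightarrow> nat) \<Rightarrow> form \<Rightarrow> nat" where
  "evf N \<rho> (PVar p) = \<rho> p"
| "evf N \<rho> Bot = 0"
| "evf N \<rho> Top = N"
| "evf N \<rho> (And A B) = min (evf N \<rho> A) (evf N \<rho> B)"
| "evf N \<rho> (Or A B) = max (evf N \<rho> A) (evf N \<rho> B)"
| "evf N \<rho> (Imp A B) = (if evf N \<rho> A \<le> evf N \<rho> B then N else evf N \<rho> B)"
| "evf N \<rho> (Circ A) = min (Suc (evf N \<rho> A)) N"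
| "evf N \<rho> (Forall p A) = Min ((\<lambda>w. evf N (\<rho>(p := w)) A) ` {..N})"
| "evf N \<rho> (Exists p A) = Max ((\<lambda>w. evf N (\<rho>(p := w)) A) ` {..N})"

definition valid_chain :: "nat \<Rightarrow> form \<Rightarrow> bool" where
  "valid_chain N A \<longleftrightarrow> (\<forall>\<rho>. (\<forall>p. \<rho> p \<le> N) \<longrightarrow> evf N \<rho> A = N)"

lemma evf_le: "(\<And>p. \<rho> p \<le> N) \<Longrightarrow> evf N \<rho> A \<le> N"
proof (induction A arbitrary: \<rho>)
  case (Forall p A)
  have "evf N (\<rho>(p := 0)) A \<le> N"
    by (rule Forall.IH) (use Forall.prems in auto)
  then show ?case by (simp add: Min_le_iff) blast
qed (simp_all add: min_le_iff_disj)

lemma evf_cong: "(\<And>p. p \<in> fv A \<Longrightarrow> \<rho> p = \<rho>' p) \<Longrightarrow> evf N \<rho> A = evf N \<rho>' A"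
proof (induction A arbitrary: \<rho> \<rho>')
  case (And A B)
  then show ?case by (metis UnCI evf.simps(4) fv.simps(4))
next
  case (Or A B)
  then show ?case by (metis UnCI evf.simps(5) fv.simps(5))
next
  case (Imp A B)
  then show ?case by (metis UnCI evf.simps(6) fv.simps(6))
next
  case (Circ A)
  then show ?case by (metis evf.simps(7) fv.simps(7))
next
  case (Forall p A)
  have "evf N (\<rho>(p := w)) A = evf N (\<rho>'(p := w)) A" for w
    by (rule Forall.IH) (use Forall.prems in auto)
  then show ?case by simp
next
  case (Exists p A)
  have "evf N (\<rho>(p := w)) A = evf N (\<rho>'(p := w)) A" for w
    by (rule Exists.IH) (use Exists.prems in auto)
  then show ?case by simp
qed simp_all

subsection \<open>Truncation\<close>

definition lev :: "nat \<Rightarrow> real" where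
  "lev n = 1 - 1 / real (Suc n)"

text \<open>Counting levels gives an inverse of \<open>lev\<close> that collapses everything from
  \<open>lev N\<close> on, including 1, to \<open>N\<close>.\<close>

definition tr :: "nat \<Rightarrow> real \<Rightarrow> nat" where
  "tr N x = card {k. k < N \<and> lev k < x}"

lemma lev_less_iff: "lev m < lev n \<longleftrightarrow> m < n"
  by (simp add: lev_def divide_inverse del: of_nat_Suc)

lemma lev_le_iff: "lev m \<le> lev n \<longleftrightarrow> m \<le> n"
  using lev_less_iff[of n m] by (metis not_less)

lemma lev_0: "lev 0 = 0"
  by (simp add: lev_def)

lemma lev_less_1: "lev n < 1"
  by (simp add: lev_def)

lemma lev_nonneg: "0 \<le> lev n"
  by (simp add: lev_def)

lemma lev_cofinal: "x < 1 \<Longrightarrow> \<exists>n. x < lev n"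
proof -
  assume "x < 1"
  then obtain n where "inverse (real (Suc n)) < 1 - x"
    using reals_Archimedean[of "1 - x"] by auto
  then show ?thesis by (intro exI[of _ n]) (simp add: lev_def divide_inverse)
qed

lemma V_up_lev: "V_up = insert 1 (range lev)"
proof -
  have "{1 - 1 / real n | n. n \<ge> 1} = range lev"
  proof (intro equalityI subsetI)
    fix x assume "x \<in> {1 - 1 / real n | n. n \<ge> 1}"
    then obtain n where "n \<ge> 1" "x = 1 - 1 / real n" by blast
    then have "x = lev (n - 1)" by (simp add: lev_def)
    then show "x \<in> range lev" by simp
  next
    fix x assume "x \<in> range lev"
    then obtain n where "x = 1 - 1 / real (Suc n)" by (auto simp: lev_def)
    then show "x \<in> {1 - 1 / real n | n. n \<ge> 1}"
      by (auto intro!: exI[of _ "Suc n"])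
  qed
  then show ?thesis by (simp add: V_up_def)
qed

text \<open>The gap condition says that nothing lies strictly between consecutive levels. In this
  form membership can be checked for infima and suprema. Conversely, if \<open>x\<close> is not 1,
  the least level above or equal to \<open>x\<close> must be \<open>x\<close> itself.\<close>

lemma V_up_iff:
  "x \<in> V_up \<longleftrightarrow> 0 \<le> x \<and> x \<le> 1 \<and> (\<forall>k. lev k < x \<longrightarrow> lev (Suc k) \<le> x)"
proof
  assume "x \<in> V_up"
  then show "0 \<le> x \<and> x \<le> 1 \<and> (\<forall>k. lev k < x \<longrightarrow> lev (Suc k) \<le> x)"
    using lev_less_1 by (auto simp: V_up_lev lev_less_iff lev_le_iff lev_nonneg less_imp_le)
next
  assume x: "0 \<le> x \<and> x \<le> 1 \<and> (\<forall>k. lev k < x \<longrightarrow> lev (Suc k) \<le> x)"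
  show "x \<in> V_up"
  proof (cases "x = 1")
    case False
    then have "\<exists>n. x \<le> lev n" using x lev_cofinal[of x] by (metis less_eq_real_def)
    then obtain n where n: "x \<le> lev n" "\<And>m. m < n \<Longrightarrow> \<not> x \<le> lev m"
      using exists_least_iff[of "\<lambda>n. x \<le> lev n"] by blast
    have "lev n \<le> x"
    proof (cases n)
      case (Suc m)
      then show ?thesis using x n(2)[of m] by simp
    qed (use x lev_0 in simp)
    with n have "x = lev n" by simp
    then show ?thesis by (simp add: V_up_lev)
  qed (simp add: V_up_lev)
qed

lemma V_up_nonempty: "V_up \<noteq> {}"
  by (simp add: V_up_lev)

text \<open>As \<open>lev\<close> increases, the set counted by \<open>tr\<close> is an initial
  segment. Every computation of \<open>tr\<close> thus reduces to comparisons with levels.\<close>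

lemma less_tr_iff:
  assumes "k < N" shows "k < tr N x \<longleftrightarrow> lev k < x"
proof
  assume k: "k < tr N x"
  show "lev k < x"
  proof (rule ccontr)
    assume "\<not> lev k < x"
    then have "{k. k < N \<and> lev k < x} \<subseteq> {..<k}"
      by (auto simp: not_less lev_le_iff dest: order_less_le_trans lev_less_iff[THEN iffD1])
    then have "tr N x \<le> card {..<k}" unfolding tr_def by (intro card_mono) auto
    with k show False by simp
  qed
next
  assume "lev k < x"
  then have "{..k} \<subseteq> {k. k < N \<and> lev k < x}"
    using assms by (auto simp: lev_le_iff intro: order_le_less_trans[of _ "lev k"])
  then have "card {..k} \<le> tr N x" unfolding tr_def by (intro card_mono) auto
  then show "k < tr N x" by simp
qed

lemma tr_le: "tr N x \<le> N"
proof -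
  have "tr N x \<le> card {..<N}" unfolding tr_def by (intro card_mono) auto
  then show ?thesis by simp
qed

lemma tr_eqI:
  assumes "y \<le> N" "\<And>k. k < N \<Longrightarrow> k < y \<longleftrightarrow> lev k < x"
  shows "tr N x = y"
  by (metis assms less_tr_iff linorder_neqE_nat order_less_irrefl order_less_le_trans tr_le)

lemma tr_lev: "tr N (lev n) = min n N"
  by (rule tr_eqI) (auto simp: lev_less_iff)

lemma tr_1: "tr N 1 = N"
  by (rule tr_eqI) (auto simp: lev_less_1)

lemma tr_mono: "x \<le> y \<Longrightarrow> tr N x \<le> tr N y"
  unfolding tr_def by (intro card_mono) auto

lemma tr_image_V_up: "tr N ` V_up = {..N}"
proof (intro equalityI subsetI)
  fix n assume "n \<in> {..N}"
  then have "n = tr N (lev n)" by (simp add: tr_lev)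
  then show "n \<in> tr N ` V_up" by (auto simp: V_up_lev)
qed (auto simp: tr_le)

lemma eq_1_iff_tr:
  assumes "x \<le> 1" shows "x = 1 \<longleftrightarrow> (\<forall>N\<ge>M. tr N x = N)"
proof
  assume *: "\<forall>N\<ge>M. tr N x = N"
  show "x = 1"
  proof (rule ccontr)
    assume "x \<noteq> 1"
    then obtain n where "x < lev n" using assms lev_cofinal[of x] by auto
    \<comment> \<open>The truncation point is chosen above both \<open>M\<close> and the level
      \<open>n\<close> that bounds \<open>x\<close>.\<close>
    then have "tr (Suc (n + M)) x \<le> n"
      using tr_mono[of x "lev n" "Suc (n + M)"] by (simp add: tr_lev)
    moreover have "tr (Suc (n + M)) x = Suc (n + M)" using * by auto
    ultimately show False by simp
  qed
qed (simp add: tr_1)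

text \<open>A strict lower bound usually survives an infimum only as a weak one. Here the gap above
  \<open>lev k\<close> turns it into the weak bound \<open>lev (Suc k)\<close>, which is again
  strict for \<open>lev k\<close>.\<close>

lemma cInf_V_up:
  assumes "S \<subseteq> V_up" "S \<noteq> {}"
  shows "Inf S \<in> V_up" "lev k < Inf S \<longleftrightarrow> (\<forall>x\<in>S. lev k < x)"
proof -
  have V: "0 \<le> x" "x \<le> 1" "lev k < x \<Longrightarrow> lev (Suc k) \<le> x" if "x \<in> S" for x k
    using that assms V_up_iff by auto
  then have bdd: "bdd_below S" by (meson bdd_belowI)
  have less: "lev k < Inf S \<longleftrightarrow> (\<forall>x\<in>S. lev k < x)" for k
  proof
    assume "\<forall>x\<in>S. lev k < x"
    then have "lev (Suc k) \<le> Inf S" using V by (intro cInf_greatest assms) auto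
    then show "lev k < Inf S" using lev_less_iff[of k "Suc k"] by simp
  next
    assume *: "lev k < Inf S"
    show "\<forall>x\<in>S. lev k < x"
    proof
      fix x assume "x \<in> S"
      then have "Inf S \<le> x" by (rule cInf_lower[OF _ bdd])
      with * show "lev k < x" by linarith
    qed
  qed
  obtain x where "x \<in> S" using assms by auto
  then have "Inf S \<le> 1" using cInf_lower[of x S] bdd V(2)[of x] by linarith
  moreover have "0 \<le> Inf S" using V assms by (intro cInf_greatest) auto
  moreover have "lev (Suc k) \<le> Inf S" if "lev k < Inf S" for k
    using V that less by (intro cInf_greatest assms) auto
  ultimately show "Inf S \<in> V_up" by (simp add: V_up_iff)
  show "lev k < Inf S \<longleftrightarrow> (\<forall>x\<in>S. lev k < x)" by (rule less)
qed

lemma cSup_V_up: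
  assumes "S \<subseteq> V_up" "S \<noteq> {}"
  shows "Sup S \<in> V_up" "lev k < Sup S \<longleftrightarrow> (\<exists>x\<in>S. lev k < x)"
proof -
  have V: "0 \<le> x" "x \<le> 1" "lev k < x \<Longrightarrow> lev (Suc k) \<le> x" if "x \<in> S" for x k
    using that assms V_up_iff by auto
  then have bdd: "bdd_above S" by (meson bdd_aboveI)
  have less: "lev k < Sup S \<longleftrightarrow> (\<exists>x\<in>S. lev k < x)" for k
    by (rule less_cSup_iff[OF assms(2) bdd])
  obtain x where "x \<in> S" using assms by auto
  then have "0 \<le> Sup S" using cSup_upper[of x S] bdd V(1)[of x] by linarith
  moreover have "Sup S \<le> 1" using V assms by (intro cSup_least) auto
  moreover have "lev (Suc k) \<le> Sup S" if "lev k < Sup S" for k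
  proof -
    obtain y where "y \<in> S" "lev k < y" using less \<open>lev k < Sup S\<close> by blast
    then show ?thesis using V(3)[of y k] cSup_upper[of y S] bdd by linarith
  qed
  ultimately show "Sup S \<in> V_up" by (simp add: V_up_iff)
  show "lev k < Sup S \<longleftrightarrow> (\<exists>x\<in>S. lev k < x)" by (rule less)
qed

lemma tr_cInf:
  assumes "S \<subseteq> V_up" "S \<noteq> {}"
  shows "tr N (Inf S) = Min (tr N ` S)"
proof -
  have fin: "finite (tr N ` S)" by (rule finite_subset[of _ "{..N}"]) (auto simp: tr_le)
  obtain x where "x \<in> S" using assms by auto
  have ne: "tr N ` S \<noteq> {}" using assms by simp
  show ?thesis
  proof (rule tr_eqI)
    show "Min (tr N ` S) \<le> N"
      using Min_le[OF fin imageI[OF \<open>x \<in> S\<close>]] tr_le[of N x] by simp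
    show "k < Min (tr N ` S) \<longleftrightarrow> lev k < Inf S" if "k < N" for k
      unfolding Min_gr_iff[OF fin ne] cInf_V_up(2)[OF assms] by (simp add: less_tr_iff that)
  qed
qed

lemma tr_cSup:
  assumes "S \<subseteq> V_up" "S \<noteq> {}"
  shows "tr N (Sup S) = Max (tr N ` S)"
proof -
  have fin: "finite (tr N ` S)" by (rule finite_subset[of _ "{..N}"]) (auto simp: tr_le)
  have ne: "tr N ` S \<noteq> {}" using assms by simp
  show ?thesis
  proof (rule tr_eqI)
    show "Max (tr N ` S) \<le> N"
      using Max_in[OF fin ne] tr_le by auto
    show "k < Max (tr N ` S) \<longleftrightarrow> lev k < Sup S" if "k < N" for k
      unfolding Max_gr_iff[OF fin ne] cSup_V_up(2)[OF assms] by (simp add: less_tr_iff that)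
  qed
qed

text \<open>Truncation can turn \<open>b < a\<close> into an equality only if \<open>b\<close> was
  already sent to the top, and then both branches give \<open>N\<close>.\<close>

lemma tr_imp_val:
  assumes "a \<in> V_up" "b \<in> V_up"
  shows "tr N (imp_val a b) = (if tr N a \<le> tr N b then N else tr N b)"
proof (cases "a \<le> b")
  case True
  then show ?thesis by (simp add: imp_val_def tr_1 tr_mono)
next
  case False
  then have "b \<noteq> 1" using V_up_le_one[OF assms(1)] by auto
  then obtain n where b: "b = lev n" using assms(2) by (auto simp: V_up_lev)
  then have "lev (Suc n) \<le> a" using False assms(1) by (simp add: V_up_iff)
  then have "min (Suc n) N \<le> tr N a" using tr_mono[of "lev (Suc n)" a N] by (simp add: tr_lev)
  then show ?thesis using False tr_le[of N a] by (auto simp: imp_val_def b tr_lev)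
qed

lemma eval_Circ_lev: "eval V_up v A = lev n \<Longrightarrow> eval V_up v (Circ A) = lev (Suc n)"
  using eval_Circ_V_up_less_one[of "Suc n" v A] by (simp add: lev_def add.commute)

lemma tr_fun_upd: "(\<lambda>q. tr N ((v(p := w)) q)) = (\<lambda>q. tr N (v q))(p := tr N w)"
  by auto

text \<open>Membership in \<open>V_up\<close> is carried along because truncation commutes with
  implication, infimum and supremum only there. Quantifiers match since \<open>tr N\<close> maps
  \<open>V_up\<close> onto the whole chain.\<close>

lemma eval_V_up_tr:
  assumes "\<And>p. v p \<in> V_up"
  shows "eval V_up v A \<in> V_up \<and> tr N (eval V_up v A) = evf N (\<lambda>q. tr N (v q)) A"
  using assms
proof (induction A arbitrary: v)
  case Bot
  then show ?case using tr_lev[of N 0] lev_0 V_up_lev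
    by (metis eval.simps(2) evf.simps(2) insert_iff min_0L rangeI)
next
  case Top
  then show ?case by (simp add: tr_1 V_up_lev)
next
  case (And A B)
  then have "eval V_up v A \<in> V_up" "eval V_up v B \<in> V_up" by auto
  then show ?case using And.IH[OF And.prems]
    tr_mono[of "eval V_up v A" "eval V_up v B" N] tr_mono[of "eval V_up v B" "eval V_up v A" N]
    by (auto simp: min_def)
next
  case (Or A B)
  then have "eval V_up v A \<in> V_up" "eval V_up v B \<in> V_up" by auto
  then show ?case using Or.IH[OF Or.prems]
    tr_mono[of "eval V_up v A" "eval V_up v B" N] tr_mono[of "eval V_up v B" "eval V_up v A" N]
    by (auto simp: max_def)
next
  case (Imp A B)
  then have "eval V_up v A \<in> V_up" "eval V_up v B \<in> V_up" by auto
  moreover from this have "imp_val (eval V_up v A) (eval V_up v B) \<in> V_up"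
    by (simp add: imp_val_def V_up_lev)
  ultimately show ?case using Imp.IH[OF Imp.prems] by (simp add: tr_imp_val)
next
  case (Circ A)
  then have IH: "eval V_up v A \<in> V_up" "tr N (eval V_up v A) = evf N (\<lambda>q. tr N (v q)) A" by auto
  show ?case
  proof (cases "eval V_up v A = 1")
    case True
    then show ?thesis
      using eval_Circ_V_up_one[OF True] IH tr_1[of N] by (simp del: eval.simps)
  next
    case False
    then obtain n where n: "eval V_up v A = lev n" using IH by (auto simp: V_up_lev)
    then have "evf N (\<lambda>q. tr N (v q)) (Circ A) = min (Suc n) N" using IH by (simp add: tr_lev)
    moreover have "lev (Suc n) \<in> V_up" by (simp add: V_up_lev)
    ultimately show ?thesis
      using eval_Circ_lev[OF n] tr_lev[of N "Suc n"] by (simp del: eval.simps evf.simps)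
  qed
next
  case (Forall p A)
  let ?S = "(\<lambda>w. eval V_up (v(p := w)) A) ` V_up"
  have IH: "eval V_up (v(p := w)) A \<in> V_up \<and>
      tr N (eval V_up (v(p := w)) A) = evf N ((\<lambda>q. tr N (v q))(p := tr N w)) A" if "w \<in> V_up" for w
    unfolding tr_fun_upd[symmetric] by (rule Forall.IH) (use Forall.prems that in auto)
  then have S: "?S \<subseteq> V_up" "?S \<noteq> {}" using V_up_nonempty by auto
  have "tr N ` ?S = (\<lambda>w. evf N ((\<lambda>q. tr N (v q))(p := w)) A) ` tr N ` V_up"
    using IH by (force simp: image_image)
  then show ?case using cInf_V_up(1)[OF S] tr_cInf[OF S] by (simp add: tr_image_V_up)
next
  case (Exists p A)
  let ?S = "(\<lambda>w. eval V_up (v(p := w)) A) ` V_up"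
  have IH: "eval V_up (v(p := w)) A \<in> V_up \<and>
      tr N (eval V_up (v(p := w)) A) = evf N ((\<lambda>q. tr N (v q))(p := tr N w)) A" if "w \<in> V_up" for w
    unfolding tr_fun_upd[symmetric] by (rule Exists.IH) (use Exists.prems that in auto)
  then have S: "?S \<subseteq> V_up" "?S \<noteq> {}" using V_up_nonempty by auto
  have "tr N ` ?S = (\<lambda>w. evf N ((\<lambda>q. tr N (v q))(p := w)) A) ` tr N ` V_up"
    using IH by (force simp: image_image)
  then show ?case using cSup_V_up(1)[OF S] tr_cSup[OF S] by (simp add: tr_image_V_up)
qed simp

text \<open>Valuations into a chain lift along \<open>lev\<close>; conversely every valuation into
  \<open>V_up\<close> is truncated at all \<open>N\<close> from \<open>M\<close> on, which together
  detect the value 1.\<close>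

lemma tautology_V_up_iff:
  "tautology V_up A \<longleftrightarrow> (\<forall>N\<ge>M. valid_chain N A)"
proof
  assume taut: "tautology V_up A"
  show "\<forall>N\<ge>M. valid_chain N A"
    unfolding valid_chain_def
  proof (intro allI impI)
    fix N and \<rho> :: "nat \<Rightarrow> nat" assume "\<forall>p. \<rho> p \<le> N"
    then have "(\<lambda>p. tr N (lev (\<rho> p))) = \<rho>" by (auto simp: tr_lev)
    then show "evf N \<rho> A = N"
      using taut eval_V_up_tr[of "\<lambda>p. lev (\<rho> p)" A N]
      by (simp add: tautology_def V_up_lev tr_1)
  qed
next
  assume valid: "\<forall>N\<ge>M. valid_chain N A"
  show "tautology V_up A"
    unfolding tautology_def
  proof (intro allI impI)
    fix v :: "nat \<Rightarrow> real" assume "\<forall>p. v p \<in> V_up"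
    then have "eval V_up v A \<in> V_up \<and> tr N (eval V_up v A) = evf N (\<lambda>q. tr N (v q)) A" for N
      by (intro eval_V_up_tr) blast
    moreover have "evf N (\<lambda>q. tr N (v q)) A = N" if "N \<ge> M" for N
      using valid that by (simp add: valid_chain_def tr_le)
    ultimately show "eval V_up v A = 1"
      using eq_1_iff_tr V_up_le_one by metis
  qed
qed

subsection \<open>Back and forth\<close>

text \<open>Since subtraction truncates, the condition on \<open>y - x\<close> says at once that the order and the
  distances, capped at \<open>2 ^ s\<close>, agree.\<close>

definition matching :: "nat \<Rightarrow> nat \<Rightarrow> nat \<Rightarrow> (nat \<times> nat) set \<Rightarrow> bool" where
  "matching N N' s R \<longleftrightarrow> (0, 0) \<in> R \<and> (N, N') \<in> R \<and> R \<subseteq> {..N} \<times> {..N'} \<and>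
     (\<forall>x x' y y'. (x, x') \<in> R \<longrightarrow> (y, y') \<in> R \<longrightarrow> min (y - x) (2 ^ s) = min (y' - x') (2 ^ s))"

lemma matching_minD:
  "matching N N' s R \<Longrightarrow> (x, x') \<in> R \<Longrightarrow> (y, y') \<in> R \<Longrightarrow> min (y - x) (2 ^ s) = min (y' - x') (2 ^ s)"
  by (auto simp: matching_def)

text \<open>With truncated subtraction, \<open>x \<le> y\<close> means \<open>x - y = 0\<close>, and
  the cap is at least 1, so it tells zero from nonzero.\<close>

lemma matching_le_iff:
  assumes "matching N N' s R" "(x, x') \<in> R" "(y, y') \<in> R"
  shows "x \<le> y \<longleftrightarrow> x' \<le> y'"
proof -
  have "(1::nat) \<le> 2 ^ s" by simp
  then show ?thesis using matching_minD[OF assms(1,3,2)] by (auto simp: min_def split: if_splits)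
qed

lemma matching_converse: "matching N N' s R \<Longrightarrow> matching N' N s (R\<inverse>)"
  unfolding matching_def by auto

lemma matching_mono:
  assumes "matching N N' s' R'" "s \<le> s'" "R \<subseteq> R'" "(0, 0) \<in> R" "(N, N') \<in> R"
  shows "matching N N' s R"
proof -
  have le: "(2::nat) ^ s \<le> 2 ^ s'" using assms(2) by simp
  have "min (y - x) (2 ^ s) = min (y' - x') (2 ^ s)" if "(x, x') \<in> R" "(y, y') \<in> R" for x x' y y'
  proof -
    have "min (y - x) (2 ^ s') = min (y' - x') (2 ^ s')"
      using that assms(3) by (intro matching_minD[OF assms(1)]) auto
    with le show ?thesis by linarith
  qed
  moreover have "R \<subseteq> {..N} \<times> {..N'}" using assms(1,3) by (auto simp: matching_def)
  ultimately show ?thesis using assms(4,5) unfolding matching_def by blast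
qed

text \<open>Let \<open>a\<close> and \<open>b\<close> be the matched neighbours of \<open>w\<close>.
  If \<open>w\<close> is closer than \<open>t\<close> to one of them, that distance is copied;
  otherwise the gap is at least \<open>2 * t\<close> on both sides, and there is room at distance
  \<open>t\<close> from both ends. Halving the cap pays for this.\<close>

lemma matching_extend:
  assumes R: "matching N N' (Suc s) R" and w: "w \<le> N"
  shows "\<exists>w'\<le>N'. matching N N' s (insert (w, w') R)"
proof -
  define t :: nat where "t = 2 ^ s"
  have t: "1 \<le> t" "2 ^ Suc s = 2 * t" by (simp_all add: t_def)
  have M: "min (y - x) (2 * t) = min (y' - x') (2 * t)" if "(x, x') \<in> R" "(y, y') \<in> R" for x x' y y'
    using matching_minD[OF R that] by (simp only: t)
  have fin: "finite R" using R unfolding matching_def by (meson finite_SigmaI finite_atMost finite_subset)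
  have 0: "(0, 0) \<in> R" and N: "(N, N') \<in> R" and sub: "R \<subseteq> {..N} \<times> {..N'}"
    using R by (auto simp: matching_def)
  have finL: "finite {x \<in> fst ` R. x \<le> w}" and finU: "finite {x \<in> fst ` R. w \<le> x}" using fin by auto
  have "Max {x \<in> fst ` R. x \<le> w} \<in> {x \<in> fst ` R. x \<le> w}"
    using 0 by (intro Max_in finL) force
  then obtain a a' where a: "(a, a') \<in> R" "a \<le> w" "a = Max {x \<in> fst ` R. x \<le> w}" by auto
  have "Min {x \<in> fst ` R. w \<le> x} \<in> {x \<in> fst ` R. w \<le> x}"
    using N w by (intro Min_in finU) force
  then obtain b b' where b: "(b, b') \<in> R" "w \<le> b" "b = Min {x \<in> fst ` R. w \<le> x}" by auto
  have ab: "x \<le> a \<or> b \<le> x" if "(x, x') \<in> R" for x x'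
  proof (cases "x \<le> w")
    case True
    then show ?thesis using that a(3) finL by (force intro!: Max_ge)
  next
    case False
    then show ?thesis using that b(3) finU by (force intro!: Min_le)
  qed
  have gap: "x' \<le> y' \<and> (y' - x' = y - x \<or> 2 * t \<le> y - x \<and> 2 * t \<le> y' - x')"
    if "(x, x') \<in> R" "(y, y') \<in> R" "x \<le> y" for x x' y y'
    using M[OF that(1,2)] M[OF that(2,1)] that(3) t(1) by (auto simp: min_def split: if_splits)
  have gab: "a' \<le> b' \<and> (b' - a' = b - a \<or> 2 * t \<le> b - a \<and> 2 * t \<le> b' - a')"
    using gap[OF a(1) b(1)] a(2) b(2) by simp
  have b': "b' \<le> N'" using b(1) sub by auto
  obtain w' where w': "a' \<le> w'" "w' \<le> b'"
    "w' - a' = w - a \<or> t \<le> w - a \<and> t \<le> w' - a'" "b' - w' = b - w \<or> t \<le> b - w \<and> t \<le> b' - w'"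
  proof (cases "w - a < t")
    case True
    then show thesis by (intro that[of "a' + (w - a)"]) (use gab a(2) b(2) in auto)
  next
    case *: False
    show thesis
    proof (cases "b - w < t")
      case True
      then show thesis by (intro that[of "b' - (b - w)"]) (use gab * a(2) b(2) in auto)
    next
      case False
      then show thesis by (intro that[of "a' + t"]) (use gab * a(2) b(2) in auto)
    qed
  qed
  have w'N: "w' \<le> N'" using w'(2) b' by simp
  \<comment> \<open>No matched element lies strictly between \<open>a\<close> and \<open>b\<close>,
    so each distance to \<open>w\<close> is a sum through \<open>a\<close> or \<open>b\<close>;
    equal or large summands give equal or large sums.\<close>
  have "min (w - x) t = min (w' - x') t \<and> min (x - w) t = min (x' - w') t" if x: "(x, x') \<in> R" for x x'
    using ab[OF x]
  proof
    assume "x \<le> a"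
    moreover from gap[OF x a(1) this] have "x' \<le> a'" "a' - x' = a - x \<or> t \<le> a - x \<and> t \<le> a' - x'" by auto
    ultimately show ?thesis using w'(1,3) a(2) by (auto simp: min_def)
  next
    assume "b \<le> x"
    moreover from gap[OF b(1) x this] have "b' \<le> x'" "x' - b' = x - b \<or> t \<le> x - b \<and> t \<le> x' - b'" by auto
    ultimately show ?thesis using w'(2,4) b(2) by (auto simp: min_def)
  qed
  moreover have "min (y - x) t = min (y' - x') t" if "(x, x') \<in> R" "(y, y') \<in> R" for x x' y y'
    using M[OF that] by linarith
  ultimately have "matching N N' s (insert (w, w') R)"
    using 0 N sub w w'N unfolding matching_def t_def[symmetric] by auto
  then show ?thesis using w'N by blast
qed

lemma matching_extend_converse:
  assumes "matching N N' (Suc s) R" and "w' \<le> N'"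
  shows "\<exists>w\<le>N. matching N N' s (insert (w, w') R)"
proof -
  obtain w where "w \<le> N" "matching N' N s (insert (w', w) (R\<inverse>))"
    using matching_extend[OF matching_converse[OF assms(1)] assms(2)] by blast
  then have "matching N N' s ((insert (w', w) (R\<inverse>))\<inverse>)"
    by (intro matching_converse)
  moreover have "(insert (w', w) (R\<inverse>))\<inverse> = insert (w, w') R" by auto
  ultimately show ?thesis using \<open>w \<le> N\<close> by auto
qed

text \<open>The number of halvings of the cap that evaluation may cost. Binary connectives evaluate
  both arguments in turn. \<circ> spends one on matching the successor and one on keeping the cap at
  least 2. A quantifier matches two new points and evaluates the body at both.\<close>

fun rank :: "form \<Rightarrow> nat" where
  "rank (And A B) = rank A + rank B"
| "rank (Or A B) = rank A + rank B"
| "rank (Imp A B) = rank A + rank B"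
| "rank (Circ A) = 2 + rank A"
| "rank (Forall p A) = 2 + 2 * rank A"
| "rank (Exists p A) = 2 + 2 * rank A"
| "rank _ = 0"

text \<open>The extremal point of each chain is matched into the other. By extremality and agreement
  of order, the image \<open>u'\<close> of \<open>w\<close> does as well as \<open>w'\<close>, so
  \<open>f w\<close> is paired with \<open>f' w'\<close>. The parameter \<open>le\<close> covers
  minimum and maximum at once.\<close>

lemma matching_extremum:
  assumes R: "matching N N' (s + (2 + 2 * r)) R"
    and step: "\<And>s R' w w'. matching N N' (s + r) R' \<Longrightarrow> R \<subseteq> R' \<Longrightarrow> (w, w') \<in> R'
      \<Longrightarrow> matching N N' s (insert (f w, f' w') R')"
    and le: "le = (\<le>) \<or> le = (\<ge>)"
    and w: "w \<le> N" "\<And>u. u \<le> N \<Longrightarrow> le (f w) (f u)"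
    and w': "w' \<le> N'" "\<And>u. u \<le> N' \<Longrightarrow> le (f' w') (f' u)"
  shows "matching N N' s (insert (f w, f' w') R)"
proof -
  have "matching N N' (Suc (Suc (s + r + r))) R" using R by (simp add: mult_2 add.assoc)
  then obtain u' where u': "u' \<le> N'" "matching N N' (Suc (s + r + r)) (insert (w, u') R)"
    using matching_extend w(1) by blast
  then obtain u where u: "u \<le> N" "matching N N' (s + r + r) (insert (u, w') (insert (w, u') R))"
    using matching_extend_converse w'(1) by blast
  let ?R = "insert (u, w') (insert (w, u') R)"
  have "matching N N' (s + r) (insert (f w, f' u') ?R)"
    by (rule step[OF u(2)]) auto
  then have m: "matching N N' s (insert (f u, f' w') (insert (f w, f' u') ?R))"
    by (rule step) auto
  have "le (f w) (f u)" "le (f' w') (f' u')" using w(2)[OF u(1)] w'(2)[OF u'(1)] .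
  moreover have "f w \<le> f u \<longleftrightarrow> f' u' \<le> f' w'" "f u \<le> f w \<longleftrightarrow> f' w' \<le> f' u'"
    by (rule matching_le_iff[OF m]; simp)+
  ultimately have "f' u' = f' w'" using le by auto
  with m show ?thesis
    by (elim matching_mono) (use R in \<open>auto simp: matching_def\<close>)
qed

lemma Min_image_atMost:
  fixes f :: "nat \<Rightarrow> nat"
  shows "\<exists>w\<le>N. Min (f ` {..N}) = f w \<and> (\<forall>u\<le>N. f w \<le> f u)"
proof -
  have "Min (f ` {..N}) \<in> f ` {..N}" by (rule Min_in) auto
  then obtain w where w: "w \<le> N" "Min (f ` {..N}) = f w" by blast
  moreover have "f w \<le> f u" if "u \<le> N" for u
    unfolding w(2)[symmetric] using that by (intro Min_le) auto
  ultimately show ?thesis by blast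
qed

lemma Max_image_atMost:
  fixes f :: "nat \<Rightarrow> nat"
  shows "\<exists>w\<le>N. Max (f ` {..N}) = f w \<and> (\<forall>u\<le>N. f u \<le> f w)"
proof -
  have "Max (f ` {..N}) \<in> f ` {..N}" by (rule Max_in) auto
  then obtain w where w: "w \<le> N" "Max (f ` {..N}) = f w" by blast
  moreover have "f u \<le> f w" if "u \<le> N" for u
    unfolding w(2)[symmetric] using that by (intro Max_ge) auto
  ultimately show ?thesis by blast
qed

text \<open>The value is inserted into \<open>R\<close> instead of being compared separately: the
  second argument of a connective is then evaluated with the first one still matched, so that their
  order agrees. Auxiliary pairs are dropped by \<open>matching_mono\<close>.\<close>

lemma evf_matching:
  assumes "matching N N' (s + rank A) R" "\<And>p. (\<rho> p, \<rho>' p) \<in> R"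
  shows "matching N N' s (insert (evf N \<rho> A, evf N' \<rho>' A) R)"
  using assms
proof (induction A arbitrary: s R \<rho> \<rho>')
  case (PVar p)
  then show ?case by (simp add: insert_absorb)
next
  case Bot
  then show ?case by (simp add: insert_absorb matching_def)
next
  case Top
  then show ?case by (simp add: insert_absorb matching_def)
next
  case (And A B)
  have "matching N N' (s + rank B) (insert (evf N \<rho> A, evf N' \<rho>' A) R)"
    using And.prems by (intro And.IH(1)) (simp_all add: ac_simps)
  then have m: "matching N N' s (insert (evf N \<rho> B, evf N' \<rho>' B) (insert (evf N \<rho> A, evf N' \<rho>' A) R))"
    using And.prems by (intro And.IH(2)) simp_all
  have "evf N \<rho> A \<le> evf N \<rho> B \<longleftrightarrow> evf N' \<rho>' A \<le> evf N' \<rho>' B"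
    by (rule matching_le_iff[OF m]) simp_all
  then show ?case using And.prems(1)
    by (intro matching_mono[OF m]) (auto simp: min_def matching_def)
next
  case (Or A B)
  have "matching N N' (s + rank B) (insert (evf N \<rho> A, evf N' \<rho>' A) R)"
    using Or.prems by (intro Or.IH(1)) (simp_all add: ac_simps)
  then have m: "matching N N' s (insert (evf N \<rho> B, evf N' \<rho>' B) (insert (evf N \<rho> A, evf N' \<rho>' A) R))"
    using Or.prems by (intro Or.IH(2)) simp_all
  have "evf N \<rho> A \<le> evf N \<rho> B \<longleftrightarrow> evf N' \<rho>' A \<le> evf N' \<rho>' B"
    by (rule matching_le_iff[OF m]) simp_all
  then show ?case using Or.prems(1)
    by (intro matching_mono[OF m]) (auto simp: max_def matching_def)
next
  case (Imp A B)
  have "matching N N' (s + rank B) (insert (evf N \<rho> A, evf N' \<rho>' A) R)"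
    using Imp.prems by (intro Imp.IH(1)) (simp_all add: ac_simps)
  then have m: "matching N N' s (insert (evf N \<rho> B, evf N' \<rho>' B) (insert (evf N \<rho> A, evf N' \<rho>' A) R))"
    using Imp.prems by (intro Imp.IH(2)) simp_all
  have "evf N \<rho> A \<le> evf N \<rho> B \<longleftrightarrow> evf N' \<rho>' A \<le> evf N' \<rho>' B"
    by (rule matching_le_iff[OF m]) simp_all
  then show ?case using Imp.prems(1)
    by (intro matching_mono[OF m]) (auto simp: matching_def)
next
  case (Circ A)
  let ?a = "evf N \<rho> A" and ?a' = "evf N' \<rho>' A"
  have m: "matching N N' (Suc (Suc s)) (insert (?a, ?a') R)"
    using Circ.prems by (intro Circ.IH) (simp_all add: ac_simps)
  have 0: "(0, 0) \<in> R" and N: "(N, N') \<in> R" using Circ.prems(1) by (auto simp: matching_def)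
  have le: "N \<le> ?a \<longleftrightarrow> N' \<le> ?a'"
    by (rule matching_le_iff[OF m]) (use N in auto)
  show ?case
  proof (cases "N \<le> ?a")
    case True
    then have "min (Suc ?a) N = N" "min (Suc ?a') N' = N'" using le by auto
    then show ?thesis using matching_mono[OF m, of s R] 0 N by (auto simp: insert_absorb)
  next
    case False
    then obtain w' where w': "w' \<le> N'"
      "matching N N' (Suc s) (insert (Suc ?a, w') (insert (?a, ?a') R))"
      using matching_extend[OF m, of "Suc ?a"] by auto
    \<comment> \<open>The cap is still at least 2, so distance 1 is recognized exactly.\<close>
    have "min (Suc ?a - ?a) (2 ^ Suc s) = min (w' - ?a') (2 ^ Suc s)"
      by (rule matching_minD[OF w'(2)]) auto
    then have "w' = Suc ?a'" using one_less_power[of "2::nat" "Suc s"]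
      by (auto simp: min_def split: if_splits)
    moreover have "min (Suc ?a) N = Suc ?a" "min (Suc ?a') N' = Suc ?a'" using False le by auto
    moreover have "matching N N' s (insert (Suc ?a, w') R)"
      by (rule matching_mono[OF w'(2)]) (use 0 N in auto)
    ultimately show ?thesis by simp
  qed
next
  case (Forall p A)
  let ?f = "\<lambda>w. evf N (\<rho>(p := w)) A" and ?f' = "\<lambda>w. evf N' (\<rho>'(p := w)) A"
  obtain w where w: "w \<le> N" "Min (?f ` {..N}) = ?f w" "\<And>u. u \<le> N \<Longrightarrow> ?f w \<le> ?f u"
    using Min_image_atMost[of N ?f] by blast
  obtain w' where w': "w' \<le> N'" "Min (?f' ` {..N'}) = ?f' w'" "\<And>u. u \<le> N' \<Longrightarrow> ?f' w' \<le> ?f' u"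
    using Min_image_atMost[of N' ?f'] by blast
  have "matching N N' s (insert (?f w, ?f' w') R)"
  proof (rule matching_extremum[where f = ?f and f' = ?f' and le = "(\<le>)"])
    show "matching N N' (s + (2 + 2 * rank A)) R" using Forall.prems(1) by simp
    show "matching N N' s (insert (?f u, ?f' u') R')"
      if "matching N N' (s + rank A) R'" "R \<subseteq> R'" "(u, u') \<in> R'" for s R' u u'
      using that Forall.prems(2) by (intro Forall.IH) auto
  qed (use w w' in auto)
  then show ?case using w(2) w'(2) by simp
next
  case (Exists p A)
  let ?f = "\<lambda>w. evf N (\<rho>(p := w)) A" and ?f' = "\<lambda>w. evf N' (\<rho>'(p := w)) A"
  obtain w where w: "w \<le> N" "Max (?f ` {..N}) = ?f w" "\<And>u. u \<le> N \<Longrightarrow> ?f w \<ge> ?f u"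
    using Max_image_atMost[of N ?f] by blast
  obtain w' where w': "w' \<le> N'" "Max (?f' ` {..N'}) = ?f' w'" "\<And>u. u \<le> N' \<Longrightarrow> ?f' w' \<ge> ?f' u"
    using Max_image_atMost[of N' ?f'] by blast
  have "matching N N' s (insert (?f w, ?f' w') R)"
  proof (rule matching_extremum[where f = ?f and f' = ?f' and le = "(\<ge>)"])
    show "matching N N' (s + (2 + 2 * rank A)) R" using Exists.prems(1) by simp
    show "matching N N' s (insert (?f u, ?f' u') R')"
      if "matching N N' (s + rank A) R'" "R \<subseteq> R'" "(u, u') \<in> R'" for s R' u u'
      using that Exists.prems(2) by (intro Exists.IH) auto
  qed (use w w' in auto)
  then show ?case using w(2) w'(2) by simp
qed

text \<open>Each variable costs one halving, so only finitely many can be matched.\<close>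

lemma matching_valuation:
  assumes "matching N N' (s + k) R" "\<And>p. \<rho> p \<le> N"
  shows "\<exists>\<rho>'. matching N N' s (R \<union> (\<lambda>p. (\<rho> p, \<rho>' p)) ` {..<k})"
  using assms(1)
proof (induction k arbitrary: s)
  case (Suc k)
  then have "matching N N' (Suc s + k) R" by simp
  then obtain \<rho>' where "matching N N' (Suc s) (R \<union> (\<lambda>p. (\<rho> p, \<rho>' p)) ` {..<k})"
    using Suc.IH by blast
  then obtain w' where w': "matching N N' s (insert (\<rho> k, w') (R \<union> (\<lambda>p. (\<rho> p, \<rho>' p)) ` {..<k}))"
    using matching_extend assms(2) by blast
  have "insert (\<rho> k, w') (R \<union> (\<lambda>p. (\<rho> p, \<rho>' p)) ` {..<k}) =
      R \<union> (\<lambda>p. (\<rho> p, (\<rho>'(k := w')) p)) ` {..<Suc k}"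
    by (auto simp: lessThan_Suc)
  then show ?case using w' by (intro exI[of _ "\<rho>'(k := w')"]) simp
qed simp

lemma valid_chain_transfer:
  assumes fv: "fv A \<subseteq> {..<k}" and valid: "valid_chain N' A"
    and N: "2 ^ (k + rank A) \<le> N" and N': "2 ^ (k + rank A) \<le> N'"
  shows "valid_chain N A"
  unfolding valid_chain_def
proof (intro allI impI)
  fix \<rho> :: "nat \<Rightarrow> nat" assume \<rho>: "\<forall>p. \<rho> p \<le> N"
  \<comment> \<open>Initially only the endpoints are matched; the size bounds make both lengths
    reach the cap.\<close>
  have "matching N N' (rank A + k) {(0, 0), (N, N')}"
    using N N' by (auto simp: matching_def add.commute)
  then obtain \<rho>' where \<rho>': "matching N N' (rank A) ({(0, 0), (N, N')} \<union> (\<lambda>p. (\<rho> p, \<rho>' p)) ` {..<k})"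
    using matching_valuation \<rho> by blast
  let ?R = "{(0, 0), (N, N')} \<union> (\<lambda>p. (\<rho> p, \<rho>' p)) ` {..<k}"
  \<comment> \<open>Variables from \<open>k\<close> on are reset to 0, whose pair
    \<open>(0, 0)\<close> is in every matching; the value of \<open>A\<close> does not
    change.\<close>
  let ?c = "\<lambda>\<rho> p. if p < k then \<rho> p else 0"
  have m: "matching N N' 0 (insert (evf N (?c \<rho>) A, evf N' (?c \<rho>') A) ?R)"
    by (rule evf_matching) (use \<rho>' in auto)
  have "?c \<rho>' p \<le> N'" for p
    using \<rho>' by (auto simp: matching_def)
  then have "evf N' (?c \<rho>') A = N'" using valid by (simp add: valid_chain_def)
  moreover have "N \<le> evf N (?c \<rho>) A \<longleftrightarrow> N' \<le> evf N' (?c \<rho>') A"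
    by (rule matching_le_iff[OF m]) auto
  ultimately have "N \<le> evf N (?c \<rho>) A" by simp
  moreover have "evf N (?c \<rho>) A \<le> N" using \<rho> by (intro evf_le) auto
  moreover have "evf N (?c \<rho>) A = evf N \<rho> A" by (rule evf_cong) (use fv in auto)
  ultimately show "evf N \<rho> A = N" by simp
qed

lemma tautology_V_up_iff_valid_chain:
  assumes "fv A \<subseteq> {..<k}" "2 ^ (k + rank A) \<le> N"
  shows "tautology V_up A \<longleftrightarrow> valid_chain N A"
proof
  assume "tautology V_up A"
  then show "valid_chain N A" using tautology_V_up_iff[of A N] by blast
next
  assume "valid_chain N A"
  then show "tautology V_up A"
    using tautology_V_up_iff[of A N] valid_chain_transfer[of A k N] assms by (meson order_trans)
qed

subsection \<open>Closure properties of recursive functions\<close>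

text \<open>\<open>recfn\<close> constrains values on lists of the wrong length as well; \<open>rf\<close> forgets them.\<close>

definition rf :: "nat \<Rightarrow> (nat list \<Rightarrow> nat) \<Rightarrow> bool" where
  "rf n f \<longleftrightarrow> (\<exists>g. recfn n g \<and> (\<forall>xs. length xs = n \<longrightarrow> f xs = g xs))"

definition rp :: "nat \<Rightarrow> (nat list \<Rightarrow> bool) \<Rightarrow> bool" where
  "rp n P \<longleftrightarrow> rf n (\<lambda>xs. if P xs then 1 else 0)"

named_theorems rf_intros

lemma rf_recfn: "recfn n f \<Longrightarrow> rf n f"
  by (auto simp: rf_def)

lemma rf_cong: "rf n f \<Longrightarrow> (\<And>xs. length xs = n \<Longrightarrow> f xs = g xs) \<Longrightarrow> rf n g"
  by (auto simp: rf_def)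

lemma rf_proj [rf_intros]: "i < n \<Longrightarrow> rf n (\<lambda>xs. xs ! i)"
  by (rule rf_recfn[OF recfn.proj])

text \<open>Bounded sums and quantifiers prepend their variable to the argument list, so the outer
  arguments then sit in the tail; under recursion two entries are prepended.\<close>

lemma rf_proj_tl [rf_intros]: "Suc i < n \<Longrightarrow> rf n (\<lambda>xs. tl xs ! i)"
  by (rule rf_cong[OF rf_proj[of "Suc i"]]) (auto simp: nth_tl)

lemma rf_proj_tl2 [rf_intros]: "Suc (Suc i) < n \<Longrightarrow> rf n (\<lambda>xs. tl (tl xs) ! i)"
  by (rule rf_cong[OF rf_proj[of "Suc (Suc i)"]]) (auto simp: nth_tl)

lemma rf_comp:
  assumes "rf (length gs) f" "\<And>g. g \<in> set gs \<Longrightarrow> rf n g"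
  shows "rf n (\<lambda>xs. f (map (\<lambda>g. g xs) gs))"
proof -
  obtain f' where f': "recfn (length gs) f'" "\<And>xs. length xs = length gs \<Longrightarrow> f xs = f' xs"
    using assms(1) by (auto simp: rf_def)
  have "\<forall>g\<in>set gs. \<exists>h. recfn n h \<and> (\<forall>xs. length xs = n \<longrightarrow> g xs = h xs)"
    using assms(2) by (simp add: rf_def)
  then obtain H where H: "\<And>g. g \<in> set gs \<Longrightarrow> recfn n (H g)"
      "\<And>g xs. g \<in> set gs \<Longrightarrow> length xs = n \<Longrightarrow> g xs = H g xs"
    by metis
  have "recfn n (\<lambda>xs. f' (map (\<lambda>g. g xs) (map H gs)))"
    by (rule recfn.comp) (use f' H in auto)
  moreover have "f (map (\<lambda>g. g xs) gs) = f' (map (\<lambda>g. g xs) (map H gs))" if "length xs = n" for xs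
    using f'(2)[of "map (\<lambda>g. g xs) gs"] H(2) that by (simp add: o_def cong: map_cong)
  ultimately show ?thesis unfolding rf_def by blast
qed

lemma rf_comp1:
  assumes "rf 1 (\<lambda>xs. F (xs ! 0))" "rf n f"
  shows "rf n (\<lambda>xs. F (f xs))"
  using rf_comp[of "[f]" "\<lambda>xs. F (xs ! 0)" n] assms by simp

lemma rf_comp2:
  assumes "rf 2 (\<lambda>xs. F (xs ! 0) (xs ! 1))" "rf n f" "rf n g"
  shows "rf n (\<lambda>xs. F (f xs) (g xs))"
  using rf_comp[of "[f, g]" "\<lambda>xs. F (xs ! 0) (xs ! 1)" n] assms by (auto simp: numeral_2_eq_2)

lemma rf_Suc [rf_intros]: "rf n f \<Longrightarrow> rf n (\<lambda>xs. Suc (f xs))"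
  by (rule rf_comp1[OF rf_recfn[OF recfn.succ]])

lemma rf_const [rf_intros]: "rf n (\<lambda>_. c)"
proof (induction c)
  case 0
  show ?case by (rule rf_recfn[OF recfn.zero])
qed (rule rf_Suc)

text \<open>\<open>recfn.prec\<close> recurses on the head of its list. Composition with
  \<open>k\<close> and all projections allows an arbitrary recursion bound and keeps
  \<open>xs\<close> as parameters.\<close>

lemma rf_rec [rf_intros]:
  assumes "rf n f" "rf (Suc (Suc n)) (\<lambda>zs. g (zs ! 0) (zs ! 1) (tl (tl zs)))" "rf n k"
  shows "rf n (\<lambda>xs. rec_nat (f xs) (\<lambda>y r. g y r xs) (k xs))"
proof -
  obtain f' where f': "recfn n f'" "\<And>xs. length xs = n \<Longrightarrow> f xs = f' xs"
    using assms(1) by (auto simp: rf_def)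
  obtain g' where g': "recfn (n + 2) g'"
      "\<And>zs. length zs = n + 2 \<Longrightarrow> g (zs ! 0) (zs ! 1) (tl (tl zs)) = g' zs"
    using assms(2) by (auto simp: rf_def)
  have "rf (n + 1) (\<lambda>xs. rec_nat (f' (tl xs)) (\<lambda>y r. g' (y # r # tl xs)) (hd xs))"
    by (rule rf_recfn[OF recfn.prec[OF f'(1) g'(1)]])
  then have "rf n (\<lambda>xs. (\<lambda>xs. rec_nat (f' (tl xs)) (\<lambda>y r. g' (y # r # tl xs)) (hd xs))
      (map (\<lambda>g. g xs) (k # map (\<lambda>i xs. xs ! i) [0..<n])))"
    by (intro rf_comp) (use assms(3) rf_proj in auto)
  then show ?thesis
  proof (rule rf_cong)
    fix xs :: "nat list" assume xs: "length xs = n"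
    have "map (\<lambda>g. g xs) (map (\<lambda>i xs. xs ! i) [0..<n]) = xs"
      using xs by (auto simp: o_def map_nth)
    moreover have "g y r xs = g' (y # r # xs)" for y r
      using g'(2)[of "y # r # xs"] xs by simp
    ultimately show "(\<lambda>xs. rec_nat (f' (tl xs)) (\<lambda>y r. g' (y # r # tl xs)) (hd xs))
        (map (\<lambda>g. g xs) (k # map (\<lambda>i xs. xs ! i) [0..<n])) =
        rec_nat (f xs) (\<lambda>y r. g y r xs) (k xs)"
      using f'(2) xs by simp
  qed
qed

lemma rf_add [rf_intros]:
  assumes "rf n f" "rf n g" shows "rf n (\<lambda>xs. f xs + g xs)"
proof -
  have "rf n (\<lambda>xs. rec_nat (f xs) (\<lambda>y r. Suc r) (g xs))"
    by (intro rf_intros assms) simp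
  moreover have "rec_nat a (\<lambda>y r. Suc r) b = a + b" for a b by (induction b) auto
  ultimately show ?thesis by simp
qed

lemma rf_mult [rf_intros]:
  assumes "rf n f" "rf n g" shows "rf n (\<lambda>xs. f xs * g xs)"
proof -
  have "rf 2 (\<lambda>xs. rec_nat 0 (\<lambda>y r. r + xs ! 0) (xs ! 1))"
    by (intro rf_intros; simp)
  moreover have "rec_nat 0 (\<lambda>y r. r + a) b = a * b" for a b by (induction b) auto
  ultimately have "rf 2 (\<lambda>xs. xs ! 0 * xs ! 1)" by simp
  then show ?thesis by (rule rf_comp2[OF _ assms])
qed

lemma rf_power [rf_intros]:
  assumes "rf n f" "rf n g" shows "rf n (\<lambda>xs. f xs ^ g xs)"
proof -
  have "rf 2 (\<lambda>xs. rec_nat 1 (\<lambda>y r. r * xs ! 0) (xs ! 1))"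
    by (intro rf_intros; simp)
  moreover have "rec_nat 1 (\<lambda>y r. r * a) b = a ^ b" for a b :: nat by (induction b) auto
  ultimately have "rf 2 (\<lambda>xs. xs ! 0 ^ xs ! 1)" by simp
  then show ?thesis by (rule rf_comp2[OF _ assms])
qed

lemma rf_diff [rf_intros]:
  assumes "rf n f" "rf n g" shows "rf n (\<lambda>xs. f xs - g xs)"
proof -
  have "rf 1 (\<lambda>xs. rec_nat 0 (\<lambda>y r. y) (xs ! 0))"
    by (intro rf_intros; simp)
  moreover have "rec_nat 0 (\<lambda>y r. y) b = b - 1" for b by (cases b) auto
  ultimately have pred: "rf 1 (\<lambda>xs. xs ! 0 - 1)" by simp
  have "rf 2 (\<lambda>xs. rec_nat (xs ! 0) (\<lambda>y r. r - 1) (xs ! 1))"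
    by (intro rf_rec rf_comp1[OF pred] rf_proj; simp)
  moreover have "rec_nat a (\<lambda>y r. r - 1) b = a - b" for a b :: nat by (induction b) auto
  ultimately have "rf 2 (\<lambda>xs. xs ! 0 - xs ! 1)" by simp
  then show ?thesis by (rule rf_comp2[OF _ assms])
qed

lemma rf_sum [rf_intros]:
  assumes "rf (Suc n) (\<lambda>zs. f (zs ! 0) (tl zs))" "rf n k"
  shows "rf n (\<lambda>xs. \<Sum>i<k xs. f i xs)"
proof -
  \<comment> \<open>The recursion step sees index, accumulator and parameters; this composition
    skips the accumulator.\<close>
  let ?h = "\<lambda>zs. (\<lambda>zs. f (zs ! 0) (tl zs)) (map (\<lambda>g. g zs)
      ((\<lambda>zs. zs ! 0) # map (\<lambda>i zs. tl (tl zs) ! i) [0..<n]))"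
  have "rf (Suc (Suc n)) ?h"
    by (intro rf_comp) (use assms(1) rf_proj rf_proj_tl2 in auto)
  then have f: "rf (Suc (Suc n)) (\<lambda>zs. f (zs ! 0) (tl (tl zs)))"
  proof (rule rf_cong)
    fix zs :: "nat list" assume "length zs = Suc (Suc n)"
    then have "map (\<lambda>i. tl (tl zs) ! i) [0..<n] = tl (tl zs)"
      using map_nth[of "tl (tl zs)"] by simp
    then show "?h zs = f (zs ! 0) (tl (tl zs))" by (simp add: o_def)
  qed
  have "rf n (\<lambda>xs. rec_nat 0 (\<lambda>y r. r + f y xs) (k xs))"
    by (intro rf_rec rf_const rf_add f assms(2) rf_proj) simp
  moreover have "rec_nat 0 (\<lambda>y r. r + f y xs) m = (\<Sum>i<m. f i xs)" for m xs
    by (induction m) auto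
  ultimately show ?thesis by simp
qed

section \<open>Predicates with recursive characteristic functions\<close>

lemma rp_cong: "rp n P \<Longrightarrow> (\<And>xs. length xs = n \<Longrightarrow> P xs = Q xs) \<Longrightarrow> rp n Q"
  unfolding rp_def by (erule rf_cong) simp

lemma rp_less [rf_intros]:
  assumes "rf n f" "rf n g" shows "rp n (\<lambda>xs. f xs < g xs)"
proof -
  \<comment> \<open>With truncated subtraction, \<open>1 - (1 - d)\<close> is the sign of
    \<open>d\<close>.\<close>
  have "rf n (\<lambda>xs. 1 - (1 - (g xs - f xs)))" by (intro rf_intros assms)
  then show ?thesis unfolding rp_def by (rule rf_cong) auto
qed

lemma rp_not [rf_intros]:
  assumes "rp n P" shows "rp n (\<lambda>xs. \<not> P xs)"
proof -
  have "rf n (\<lambda>xs. 1 - (if P xs then 1 else 0))"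
    by (rule rf_diff[OF rf_const assms[unfolded rp_def]])
  then show ?thesis unfolding rp_def by (rule rf_cong) auto
qed

lemma rp_conj [rf_intros]:
  assumes "rp n P" "rp n Q" shows "rp n (\<lambda>xs. P xs \<and> Q xs)"
proof -
  have "rf n (\<lambda>xs. (if P xs then 1 else 0) * (if Q xs then 1 else 0))"
    by (rule rf_mult[OF assms[unfolded rp_def]])
  then show ?thesis unfolding rp_def by (rule rf_cong) auto
qed

lemma rp_disj [rf_intros]:
  assumes "rp n P" "rp n Q" shows "rp n (\<lambda>xs. P xs \<or> Q xs)"
  by (rule rp_cong[OF rp_not[OF rp_conj[OF rp_not[OF assms(1)] rp_not[OF assms(2)]]]]) auto

lemma rp_le [rf_intros]:
  assumes "rf n f" "rf n g" shows "rp n (\<lambda>xs. f xs \<le> g xs)"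
  by (rule rp_cong[OF rp_not[OF rp_less[OF assms(2,1)]]]) auto

lemma rp_eq [rf_intros]:
  assumes "rf n f" "rf n g" shows "rp n (\<lambda>xs. f xs = g xs)"
  by (rule rp_cong[OF rp_conj[OF rp_le[OF assms] rp_le[OF assms(2,1)]]]) auto

lemma rp_imp [rf_intros]:
  assumes "rp n P" "rp n Q" shows "rp n (\<lambda>xs. P xs \<longrightarrow> Q xs)"
  by (rule rp_cong[OF rp_disj[OF rp_not[OF assms(1)] assms(2)]]) auto

lemma rf_if [rf_intros]:
  assumes "rp n P" "rf n f" "rf n g" shows "rf n (\<lambda>xs. if P xs then f xs else g xs)"
proof -
  have "rf n (\<lambda>xs. (if P xs then 1 else 0) * f xs + (1 - (if P xs then 1 else 0)) * g xs)"
    by (intro rf_add rf_mult rf_diff rf_const assms(1)[unfolded rp_def] assms(2,3))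
  then show ?thesis by (rule rf_cong) auto
qed

lemma rp_all [rf_intros]:
  assumes "rp (Suc n) (\<lambda>zs. P (zs ! 0) (tl zs))" "rf n k"
  shows "rp n (\<lambda>xs. \<forall>i<k xs. P i xs)"
proof -
  \<comment> \<open>The sum counts the counterexamples.\<close>
  have "rf n (\<lambda>xs. \<Sum>i<k xs. if \<not> P i xs then 1 else 0)"
    by (rule rf_sum[OF rp_not[OF assms(1), unfolded rp_def] assms(2)])
  then have "rp n (\<lambda>xs. (\<Sum>i<k xs. if \<not> P i xs then 1 else 0) = (0::nat))"
    by (rule rp_eq[OF _ rf_const])
  then show ?thesis by (rule rp_cong) auto
qed

lemma rf_min [rf_intros]:
  assumes "rf n f" "rf n g" shows "rf n (\<lambda>xs. min (f xs) (g xs))"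
  unfolding min_def by (intro rf_intros assms)

lemma rf_max [rf_intros]:
  assumes "rf n f" "rf n g" shows "rf n (\<lambda>xs. max (f xs) (g xs))"
  unfolding max_def by (intro rf_intros assms)

text \<open>The quotient counts the positive multiples of \<open>y\<close> up to
  \<open>x\<close>.\<close>

lemma div_eq_sum:
  assumes "0 < (y::nat)" shows "x div y = (\<Sum>i<x. if Suc i * y \<le> x then 1 else 0)"
proof -
  have *: "{i\<in>{..<x}. i < x div y} = {..<x div y}"
    by (auto intro: order_less_le_trans[OF _ div_le_dividend])
  have "Suc i * y \<le> x \<longleftrightarrow> i < x div y" for i
    unfolding Suc_le_eq[symmetric] by (rule less_eq_div_iff_mult_less_eq[OF assms, symmetric])
  then have "(\<Sum>i<x. if Suc i * y \<le> x then 1 else 0) = (\<Sum>i<x. if i < x div y then 1 else (0::nat))"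
    by (simp only:)
  also have "\<dots> = (\<Sum>i\<in>{i\<in>{..<x}. i < x div y}. 1)"
    by (rule sum.inter_filter[symmetric]) simp
  also have "\<dots> = x div y" unfolding * by simp
  finally show ?thesis by (rule sym)
qed

lemma rf_div [rf_intros]:
  assumes "rf n f" "rf n g" shows "rf n (\<lambda>xs. f xs div g xs)"
proof -
  have "rf 2 (\<lambda>xs. if 0 < xs ! 1 then \<Sum>i<xs ! 0. if Suc i * xs ! 1 \<le> xs ! 0 then 1 else 0 else 0)"
    by (intro rf_intros; simp)
  then have "rf 2 (\<lambda>xs. xs ! 0 div xs ! 1)"
    by (rule rf_cong) (simp add: div_eq_sum)
  then show ?thesis by (rule rf_comp2[OF _ assms])
qed

lemma rf_mod [rf_intros]:
  assumes "rf n f" "rf n g" shows "rf n (\<lambda>xs. f xs mod g xs)"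
  unfolding minus_div_mult_eq_mod[symmetric] by (intro rf_intros assms)

lemma rf_prod_encode [rf_intros]:
  assumes "rf n f" "rf n g" shows "rf n (\<lambda>xs. prod_encode (f xs, g xs))"
  unfolding prod_encode_def triangle_def prod.case by (intro rf_intros assms)

section \<open>Projections of the pairing function\<close>

definition pfst :: "nat \<Rightarrow> nat" where "pfst z = fst (prod_decode z)"
definition psnd :: "nat \<Rightarrow> nat" where "psnd z = snd (prod_decode z)"

lemma prod_encode_pfst_psnd: "prod_encode (pfst z, psnd z) = z"
  by (simp add: pfst_def psnd_def)

lemma pfst_le: "pfst z \<le> z" and psnd_le: "psnd z \<le> z"
  using le_prod_encode_1[of "pfst z" "psnd z"] le_prod_encode_2[of "psnd z" "pfst z"]
  by (simp_all add: prod_encode_pfst_psnd)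

lemma prod_encode_eq_iff: "prod_encode (a, b) = z \<longleftrightarrow> a = pfst z \<and> b = psnd z"
  by (metis prod_encode_pfst_psnd prod_encode_eq prod.inject)

lemma sum_sum_delta:
  assumes "a < (k::nat)" "b < k"
  shows "(\<Sum>i<k. \<Sum>j<k. if i = a \<and> j = b then f i j else (0::nat)) = f a b"
proof -
  have "(\<Sum>j<k. if i = a \<and> j = b then f i j else 0) = (if i = a then f i b else 0)" for i
    using assms by (cases "i = a") (simp_all add: sum.delta')
  then show ?thesis using assms by simp
qed

lemma rf_pfst [rf_intros]:
  assumes "rf n f" shows "rf n (\<lambda>xs. pfst (f xs))"
proof -
  \<comment> \<open>Both components are bounded by the code, so a double sum with a single matching
    pair decodes without unbounded search.\<close>
  have "rf 1 (\<lambda>xs. \<Sum>i<Suc (xs ! 0). \<Sum>j<Suc (xs ! 0). if prod_encode (i, j) = xs ! 0 then i else 0)"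
    by (intro rf_intros; simp)
  moreover have "(\<Sum>i<Suc z. \<Sum>j<Suc z. if prod_encode (i, j) = z then i else 0) = pfst z" for z
    unfolding prod_encode_eq_iff by (intro sum_sum_delta) (simp_all add: less_Suc_eq_le pfst_le psnd_le)
  ultimately have "rf 1 (\<lambda>xs. pfst (xs ! 0))" by simp
  then show ?thesis by (rule rf_comp1[OF _ assms])
qed

lemma rf_psnd [rf_intros]:
  assumes "rf n f" shows "rf n (\<lambda>xs. psnd (f xs))"
proof -
  have "rf 1 (\<lambda>xs. \<Sum>i<Suc (xs ! 0). \<Sum>j<Suc (xs ! 0). if prod_encode (i, j) = xs ! 0 then j else 0)"
    by (intro rf_intros; simp)
  moreover have "(\<Sum>i<Suc z. \<Sum>j<Suc z. if prod_encode (i, j) = z then j else 0) = psnd z" for z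
    unfolding prod_encode_eq_iff by (intro sum_sum_delta) (simp_all add: less_Suc_eq_le pfst_le psnd_le)
  ultimately have "rf 1 (\<lambda>xs. psnd (xs ! 0))" by simp
  then show ?thesis by (rule rf_comp1[OF _ assms])
qed

subsection \<open>Truth tables\<close>

lemma rf_tl:
  assumes "rf n f" shows "rf (Suc n) (\<lambda>zs. f (tl zs))"
proof -
  let ?h = "\<lambda>zs. f (map (\<lambda>g. g zs) (map (\<lambda>i zs. tl zs ! i) [0..<n]))"
  have "rf (Suc n) ?h"
    by (intro rf_comp) (use assms rf_proj_tl in auto)
  then show ?thesis
  proof (rule rf_cong)
    fix zs :: "nat list" assume "length zs = Suc n"
    then have "map (\<lambda>i. tl zs ! i) [0..<n] = tl zs"
      using map_nth[of "tl zs"] by simp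
    then show "?h zs = f (tl zs)" by (simp add: o_def)
  qed
qed

lemma rp_ex [rf_intros]:
  assumes "rp (Suc n) (\<lambda>zs. P (zs ! 0) (tl zs))" "rf n k"
  shows "rp n (\<lambda>xs. \<exists>i<k xs. P i xs)"
  by (rule rp_cong[OF rp_not[OF rp_all[OF rp_not[OF assms(1)] assms(2)]]]) auto

section \<open>Finite sequences as digits of a number\<close>

definition dig :: "nat \<Rightarrow> nat \<Rightarrow> nat \<Rightarrow> nat" where
  "dig b x i = x div b ^ i mod b"

text \<open>Course-of-values recursion: digit \<open>m\<close> is computed by \<open>g\<close> from
  the number \<open>h\<close> that holds all earlier digits.\<close>

definition expansion :: "nat \<Rightarrow> (nat \<Rightarrow> nat \<Rightarrow> nat) \<Rightarrow> nat \<Rightarrow> nat" where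
  "expansion b g k = rec_nat 0 (\<lambda>m h. h + g m h * b ^ m) k"

lemma rf_dig [rf_intros]:
  "rf n b \<Longrightarrow> rf n x \<Longrightarrow> rf n i \<Longrightarrow> rf n (\<lambda>xs. dig (b xs) (x xs) (i xs))"
  unfolding dig_def by (intro rf_intros)

lemma expansion_Suc: "expansion b g (Suc k) = expansion b g k + g k (expansion b g k) * b ^ k"
  by (simp add: expansion_def)

lemma expansion_less:
  assumes "\<And>m h. g m h < b" shows "expansion b g k < b ^ k"
proof (induction k)
  case 0
  show ?case by (simp add: expansion_def)
next
  case (Suc k)
  have "Suc (g k (expansion b g k)) * b ^ k \<le> b * b ^ k"
    using assms by (intro mult_le_mono1) (simp add: Suc_le_eq)
  then show ?case using Suc by (simp add: expansion_Suc)
qed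

text \<open>The part built before stage \<open>m\<close> is below \<open>b ^ m\<close>, and later
  stages add multiples of \<open>b ^ Suc m\<close>, so a digit is never altered once
  written.\<close>

lemma dig_expansion:
  assumes "\<And>m h. g m h < b" "m < k"
  shows "dig b (expansion b g k) m = g m (expansion b g m)"
  using assms(2)
proof (induction k)
  case (Suc k)
  let ?h = "expansion b g k"
  have b: "0 < b" using assms(1)[of 0 0] by simp
  have h: "?h < b ^ k" by (rule expansion_less) (rule assms)
  show ?case
  proof (cases "m = k")
    case True
    then show ?thesis using h b assms(1) by (simp add: dig_def expansion_Suc)
  next
    case False
    then obtain d where d: "k = m + Suc d" using Suc.prems less_imp_Suc_add[of m k] by auto
    have "(?h + g k ?h * b ^ k) div b ^ m = (?h + b ^ m * (g k ?h * b ^ d * b)) div b ^ m"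
      by (simp add: d power_add ac_simps)
    also have "\<dots> = g k ?h * b ^ d * b + ?h div b ^ m"
      using b by (subst div_mult_self2) simp_all
    finally have "dig b (expansion b g (Suc k)) m = dig b ?h m"
      by (simp add: dig_def expansion_Suc)
    then show ?thesis using Suc False by simp
  qed
qed simp

lemma dig_less: "dig (Suc b) x i < Suc b"
  by (simp add: dig_def)

lemma ex_dig:
  assumes "\<And>p. \<rho> p \<le> b"
  shows "\<exists>e<Suc b ^ k. \<forall>p<k. dig (Suc b) e p = \<rho> p"
proof (intro exI conjI allI impI)
  let ?e = "expansion (Suc b) (\<lambda>m _. \<rho> m) k"
  show "?e < Suc b ^ k" by (rule expansion_less) (use assms in \<open>simp add: less_Suc_eq_le\<close>)
  show "dig (Suc b) ?e p = \<rho> p" if "p < k" for p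
    by (rule dig_expansion) (use assms that in \<open>simp_all add: less_Suc_eq_le\<close>)
qed

text \<open>Lets a quantifier over values of \<open>p\<close> become a bounded search over codes of
  valuations, so that updating a single digit need not be programmed.\<close>

definition variant :: "nat \<Rightarrow> nat \<Rightarrow> nat \<Rightarrow> nat \<Rightarrow> nat \<Rightarrow> bool" where
  "variant N k p e e' \<longleftrightarrow> (\<forall>q<k. q = p \<or> dig (Suc N) e' q = dig (Suc N) e q)"

text \<open>\<open>T a e\<close> is meant to be 0 if \<open>a\<close> is not the code of a formula, and otherwise one more than the value
  of that formula under the valuation whose values at the variables below \<open>k\<close> are the digits of
  \<open>e\<close> in base \<open>N + 1\<close>. A maximum or minimum \<open>y \<le> N + 1\<close> is computed by counting the \<open>x < y\<close>.\<close>

definition step :: "nat \<Rightarrow> nat \<Rightarrow> (nat \<Rightarrow> nat \<Rightarrow> nat) \<Rightarrow> nat \<Rightarrow> nat \<Rightarrow> nat" where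
  "step N k T a e =
    (if pfst a = 0 then Suc (dig (Suc N) e (psnd a))
     else if pfst a = 1 then if psnd a = 0 then 1 else 0
     else if pfst a = 2 then if psnd a = 0 then Suc N else 0
     else if pfst a = 3 then min (T (pfst (psnd a)) e) (T (psnd (psnd a)) e)
     else if pfst a = 4 then
       if T (pfst (psnd a)) e = 0 \<or> T (psnd (psnd a)) e = 0 then 0
       else max (T (pfst (psnd a)) e) (T (psnd (psnd a)) e)
     else if pfst a = 5 then
       if T (pfst (psnd a)) e = 0 \<or> T (psnd (psnd a)) e = 0 then 0
       else if T (pfst (psnd a)) e \<le> T (psnd (psnd a)) e then Suc N else T (psnd (psnd a)) e
     else if pfst a = 6 then if T (psnd a) e = 0 then 0 else min (Suc (T (psnd a) e)) (Suc N)
     else if pfst a = 7 then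
       \<Sum>x<Suc N. if \<forall>e'<Suc N ^ k. variant N k (pfst (psnd a)) e e' \<longrightarrow> x < T (psnd (psnd a)) e'
         then 1 else 0
     else if pfst a = 8 then
       \<Sum>x<Suc N. if \<exists>e'<Suc N ^ k. variant N k (pfst (psnd a)) e e' \<and> x < T (psnd (psnd a)) e'
         then 1 else 0
     else 0)"

text \<open>Entries range up to \<open>Suc N\<close>, hence base \<open>Suc (Suc N)\<close>. Rows
  are ordered by \<open>a\<close>, so those of smaller codes are written first.\<close>

definition lookup :: "nat \<Rightarrow> nat \<Rightarrow> nat \<Rightarrow> nat \<Rightarrow> nat \<Rightarrow> nat" where
  "lookup N k h a e = dig (Suc (Suc N)) h (a * Suc N ^ k + e)"

definition truth_table :: "nat \<Rightarrow> nat \<Rightarrow> nat \<Rightarrow> nat" where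
  "truth_table N k = expansion (Suc (Suc N))
     (\<lambda>m h. step N k (lookup N k h) (m div Suc N ^ k) (m mod Suc N ^ k))"

lemma rp_variant [rf_intros]:
  assumes "rf n N" "rf n k" "rf n p" "rf n e" "rf n e'"
  shows "rp n (\<lambda>xs. variant (N xs) (k xs) (p xs) (e xs) (e' xs))"
  unfolding variant_def by (intro rf_intros assms assms[THEN rf_tl]) simp_all

lemma rf_lookup [rf_intros]:
  assumes "rf n N" "rf n k" "rf n h" "rf n a" "rf n e"
  shows "rf n (\<lambda>xs. lookup (N xs) (k xs) (h xs) (a xs) (e xs))"
  unfolding lookup_def by (intro rf_intros assms)

lemma rf_step [rf_intros]:
  assumes "rf n N" "rf n k" "rf n h" "rf n a" "rf n e"
  shows "rf n (\<lambda>xs. step (N xs) (k xs) (lookup (N xs) (k xs) (h xs)) (a xs) (e xs))"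
  unfolding step_def
  by (intro rf_intros assms assms[THEN rf_tl] assms[THEN rf_tl, THEN rf_tl]) simp_all

lemma rf_truth_table [rf_intros]:
  assumes "rf n N" "rf n k" "rf n K"
  shows "rf n (\<lambda>xs. truth_table (N xs) (k xs) (K xs))"
  unfolding truth_table_def expansion_def
  by (intro rf_intros assms assms[THEN rf_tl, THEN rf_tl]) simp_all

lemma lookup_le: "lookup N k h a e \<le> Suc N"
  unfolding lookup_def using dig_less[of "Suc N"] by (simp add: less_Suc_eq_le)

lemma sum_indicator_le: "(\<Sum>x<n. if P x then 1 else 0) \<le> (n::nat)"
  using sum_bounded_above[of "{..<n}" "\<lambda>x. if P x then 1 else 0" "1::nat"] by simp

lemma step_le:
  assumes "\<And>a e. T a e \<le> Suc N"
  shows "step N k T a e \<le> Suc N"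
  unfolding step_def using assms dig_less[of N] sum_indicator_le[where n = "Suc N"]
  by (simp add: less_Suc_eq_le min.coboundedI1 del: sum.lessThan_Suc)

text \<open>Only variables carry tag 0; for all other tags the payload is strictly smaller, so
  \<open>step\<close> consults earlier rows only.\<close>

lemma psnd_less: "pfst a \<noteq> 0 \<Longrightarrow> psnd a < a"
proof -
  assume "pfst a \<noteq> 0"
  moreover have "n \<le> triangle n" for n by (induction n) auto
  then have "pfst a + psnd a + pfst a \<le> prod_encode (pfst a, psnd a)"
    by (simp add: prod_encode_def)
  ultimately show ?thesis by (simp add: prod_encode_pfst_psnd)
qed

lemma step_cong:
  assumes "\<And>a' e'. a' < a \<Longrightarrow> e' < Suc N ^ k \<Longrightarrow> T a' e' = T' a' e'" "e < Suc N ^ k"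
  shows "step N k T a e = step N k T' a e"
proof (cases "pfst a = 0")
  case False
  have less: "psnd a < a" "pfst (psnd a) < a" "psnd (psnd a) < a"
    using psnd_less[OF False] pfst_le[of "psnd a"] psnd_le[of "psnd a"] by linarith+
  show ?thesis
    unfolding step_def using assms(1)[OF less(1)] assms(1)[OF less(2)] assms(1)[OF less(3)] assms(2)
    by (simp cong: conj_cong imp_cong)
qed (simp add: step_def)

text \<open>An entry is computed from a partial table, but \<open>step\<close> reads only rows of
  smaller codes, which are complete by then and never change. Hence the finished table satisfies the
  defining equation.\<close>

lemma lookup_truth_table:
  fixes N k :: nat
  defines "E \<equiv> Suc N ^ k"
  assumes "a < K" "e < E"
  shows "lookup N k (truth_table N k (K * E)) a e =
    step N k (lookup N k (truth_table N k (K * E))) a e"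
proof -
  have less: "step N k (lookup N k h) a e < Suc (Suc N)" for h a e
    using step_le[OF lookup_le] by (simp add: less_Suc_eq_le)
  have index: "a' * E + e' < m * E" if "a' < m" "e' < E" for a' e' m
  proof -
    have "Suc a' * E \<le> m * E" using that by (intro mult_le_mono1) simp
    with that show ?thesis by simp
  qed
  have lookup: "lookup N k (truth_table N k m) a' e' =
      step N k (lookup N k (truth_table N k (a' * E + e'))) a' e'"
    if "a' * E + e' < m" "e' < E" for m a' e'
  proof -
    have "lookup N k (truth_table N k m) a' e' = dig (Suc (Suc N)) (truth_table N k m) (a' * E + e')"
      by (simp add: lookup_def E_def)
    also have "\<dots> = step N k (lookup N k (truth_table N k (a' * E + e')))
        ((a' * E + e') div E) ((a' * E + e') mod E)"
      unfolding truth_table_def E_def[symmetric] by (rule dig_expansion[OF less that(1)])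
    finally show ?thesis using that(2) by simp
  qed
  have "lookup N k (truth_table N k (K * E)) a e =
      step N k (lookup N k (truth_table N k (a * E + e))) a e"
    using assms(2,3) index by (intro lookup) auto
  also have "\<dots> = step N k (lookup N k (truth_table N k (K * E))) a e"
  proof (rule step_cong)
    fix a' e' assume *: "a' < a" "e' < Suc N ^ k"
    then have "a' * E + e' < a * E + e" "a' * E + e' < K * E"
      using index[of a' a e'] index[of a' K e'] assms(2) by (auto simp: E_def)
    then show "lookup N k (truth_table N k (a * E + e)) a' e' =
        lookup N k (truth_table N k (K * E)) a' e'"
      using lookup * by (simp add: E_def)
  qed (use assms in simp)
  finally show ?thesis .
qed

section \<open>Bounding variables and rank by the code\<close>

lemma pfst_prod_encode [simp]: "pfst (prod_encode (a, b)) = a"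
  and psnd_prod_encode [simp]: "psnd (prod_encode (a, b)) = b"
  by (simp_all add: pfst_def psnd_def)

lemma less_prod_encode: "0 < t \<Longrightarrow> r < prod_encode (t, r)"
  using psnd_less[of "prod_encode (t, r)"] by simp

lemma less_prod_encode_prod_encode:
  assumes "0 < t"
  shows "a < prod_encode (t, prod_encode (a, b))" "b < prod_encode (t, prod_encode (a, b))"
  using less_prod_encode[OF assms, of "prod_encode (a, b)"]
    le_prod_encode_1[of a b] le_prod_encode_2[of b a] by linarith+

lemma code_less:
  "code A < code (And A B)" "code B < code (And A B)"
  "code A < code (Or A B)" "code B < code (Or A B)"
  "code A < code (Imp A B)" "code B < code (Imp A B)"
  "code A < code (Circ A)"
  "code A < code (Forall p A)" "p < code (Forall p A)"
  "code A < code (Exists p A)" "p < code (Exists p A)"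
  by (simp_all add: less_prod_encode less_prod_encode_prod_encode)

lemma fv_le_code: "p \<in> fv A \<Longrightarrow> p \<le> code A"
proof (induction A)
  case (PVar q)
  then show ?case by (simp add: le_prod_encode_2)
next
  case (And A B)
  then show ?case using code_less(1,2)[where A = A and B = B] by (auto simp del: code.simps)
next
  case (Or A B)
  then show ?case using code_less(3,4)[where A = A and B = B] by (auto simp del: code.simps)
next
  case (Imp A B)
  then show ?case using code_less(5,6)[where A = A and B = B] by (auto simp del: code.simps)
next
  case (Circ A)
  then show ?case using code_less(7)[of A] by (auto simp del: code.simps)
next
  case (Forall q A)
  then show ?case using code_less(8)[where A = A and p = q] by (auto simp del: code.simps)
next
  case (Exists q A)
  then show ?case using code_less(10)[where A = A and p = q] by (auto simp del: code.simps)
qed simp_all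

text \<open>The code grows by at least one at each constructor, while the rank is at most a sum of
  two smaller ones or twice a smaller one plus 2; a factor 4 absorbs either. A bound in the code
  itself spares computing the rank.\<close>

lemma rank_le: "rank A \<le> 4 ^ code A"
proof -
  have add: "(4::nat) ^ a + 4 ^ b \<le> 4 ^ c" if "a < c" "b < c" for a b c
  proof -
    from that obtain d where c: "c = Suc d" "a \<le> d" "b \<le> d" by (cases c) auto
    then have "(4::nat) ^ a \<le> 4 ^ d" "(4::nat) ^ b \<le> 4 ^ d" by (simp_all add: power_increasing)
    then show ?thesis unfolding c(1) power_Suc by linarith
  qed
  have double: "2 + 2 * (4::nat) ^ a \<le> 4 ^ c" if "a < c" for a c
  proof -
    from that obtain d where c: "c = Suc d" "a \<le> d" by (cases c) auto
    then have "(4::nat) ^ a \<le> 4 ^ d" by (simp add: power_increasing)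
    moreover have "(1::nat) \<le> 4 ^ d" by simp
    ultimately show ?thesis unfolding c power_Suc by linarith
  qed
  show ?thesis
  proof (induction A)
    case (And A B)
    then show ?case using add[OF code_less(1,2)[where A = A and B = B]] by (simp del: code.simps)
  next
    case (Or A B)
    then show ?case using add[OF code_less(3,4)[where A = A and B = B]] by (simp del: code.simps)
  next
    case (Imp A B)
    then show ?case using add[OF code_less(5,6)[where A = A and B = B]] by (simp del: code.simps)
  next
    case (Circ A)
    then show ?case using double[OF code_less(7)[of A]] by (simp del: code.simps)
  next
    case (Forall p A)
    then show ?case using double[OF code_less(8)[where A = A and p = p]] by (simp del: code.simps)
  next
    case (Exists p A)
    then show ?case using double[OF code_less(10)[where A = A and p = p]] by (simp del: code.simps)
  qed simp_all
qed

lemma sum_less_indicator: "s \<le> n \<Longrightarrow> (\<Sum>x<n. if x < s then 1 else 0) = (s::nat)"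
proof -
  assume "s \<le> n"
  then have "{x \<in> {..<n}. x < s} = {..<s}" by auto
  then show ?thesis using sum.inter_filter[of "{..<n}" "\<lambda>_. 1::nat" "\<lambda>x. x < s"] by simp
qed

section \<open>Correctness of the truth table\<close>

lemma variant_evf:
  assumes "fv A \<subseteq> {..<k}" "variant N k p e e'"
  shows "evf N (dig (Suc N) e') A = evf N ((dig (Suc N) e)(p := dig (Suc N) e' p)) A"
  by (rule evf_cong) (use assms in \<open>auto simp: variant_def\<close>)

lemma ex_variant:
  assumes "w \<le> N" "p < k"
  shows "\<exists>e'<Suc N ^ k. variant N k p e e' \<and> dig (Suc N) e' p = w"
proof -
  have "((dig (Suc N) e)(p := w)) q \<le> N" for q
    using assms dig_less[of N] by (simp add: less_Suc_eq_le)
  then obtain e' where "e' < Suc N ^ k" "\<forall>q<k. dig (Suc N) e' q = ((dig (Suc N) e)(p := w)) q"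
    using ex_dig[of "(dig (Suc N) e)(p := w)" N k] by blast
  then show ?thesis
    using assms(2) by (intro exI[of _ e']) (simp add: variant_def)
qed

lemma variants_evf:
  assumes "fv A \<subseteq> {..<k}" "p < k"
  shows "(\<forall>e'<Suc N ^ k. variant N k p e e' \<longrightarrow> Q (evf N (dig (Suc N) e') A)) \<longleftrightarrow>
    (\<forall>w\<le>N. Q (evf N ((dig (Suc N) e)(p := w)) A))"
proof (intro iffI allI impI)
  fix w assume *: "\<forall>e'<Suc N ^ k. variant N k p e e' \<longrightarrow> Q (evf N (dig (Suc N) e') A)" "w \<le> N"
  then obtain e' where "e' < Suc N ^ k" "variant N k p e e'" "dig (Suc N) e' p = w"
    using ex_variant assms(2) by blast
  then show "Q (evf N ((dig (Suc N) e)(p := w)) A)"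
    using * variant_evf[OF assms(1)] by metis
next
  fix e' assume *: "\<forall>w\<le>N. Q (evf N ((dig (Suc N) e)(p := w)) A)" "variant N k p e e'"
  have "dig (Suc N) e' p \<le> N" using dig_less[of N] by (simp add: less_Suc_eq_le)
  then show "Q (evf N (dig (Suc N) e') A)"
    using * variant_evf[OF assms(1)] by metis
qed

text \<open>The bound \<open>k\<close> on codes is also the number of variables: variables, bound
  ones included, are at most the code of the formula in which they occur.\<close>

lemma table_code:
  assumes T: "\<And>a e. a < k \<Longrightarrow> e < Suc N ^ k \<Longrightarrow> T a e = step N k T a e"
    and "code A < k" "e < Suc N ^ k"
  shows "T (code A) e = Suc (evf N (dig (Suc N) e) A)"
  using assms(2,3)
proof (induction A arbitrary: e)
  case (And A B)
  then show ?case using code_less(1,2)[where A = A and B = B] by (subst T) (simp_all add: step_def del: sum.lessThan_Suc)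
next
  case (Or A B)
  then show ?case using code_less(3,4)[where A = A and B = B] by (subst T) (simp_all add: step_def del: sum.lessThan_Suc)
next
  case (Imp A B)
  then show ?case using code_less(5,6)[where A = A and B = B] by (subst T) (simp_all add: step_def del: sum.lessThan_Suc)
next
  case (Circ A)
  then show ?case using code_less(7)[of A] by (subst T) (simp_all add: step_def del: sum.lessThan_Suc)
next
  case (Forall p A)
  let ?v = "evf N (dig (Suc N) e) (Forall p A)"
  have less: "code A < k" "p < k" using Forall.prems(1) code_less(8,9)[where A = A and p = p] by linarith+
  have fv: "fv A \<subseteq> {..<k}" using fv_le_code less(1) by (auto intro: order_le_less_trans)
  have IH: "T (code A) e' = Suc (evf N (dig (Suc N) e') A)" if "e' < Suc N ^ k" for e'
    using Forall.IH less(1) that by blast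
  have "(\<forall>e'<Suc N ^ k. variant N k p e e' \<longrightarrow> x < T (code A) e') \<longleftrightarrow> x < Suc ?v" for x
    using variants_evf[OF fv less(2), of N e "\<lambda>y. x \<le> y"] IH by (auto simp: less_Suc_eq_le)
  moreover have "?v \<le> N" using dig_less[of N] by (intro evf_le) (simp add: less_Suc_eq_le)
  ultimately show ?case using Forall.prems
    by (subst T) (simp_all add: step_def sum_less_indicator del: sum.lessThan_Suc evf.simps)
next
  case (Exists p A)
  let ?v = "evf N (dig (Suc N) e) (Exists p A)"
  have less: "code A < k" "p < k" using Exists.prems(1) code_less(10,11)[where A = A and p = p] by linarith+
  have fv: "fv A \<subseteq> {..<k}" using fv_le_code less(1) by (auto intro: order_le_less_trans)
  have IH: "T (code A) e' = Suc (evf N (dig (Suc N) e') A)" if "e' < Suc N ^ k" for e'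
    using Exists.IH less(1) that by blast
  have "(\<exists>e'<Suc N ^ k. variant N k p e e' \<and> x < T (code A) e') \<longleftrightarrow> x < Suc ?v" for x
    \<comment> \<open>The existential case is the universal one for the negated predicate.\<close>
    using variants_evf[OF fv less(2), of N e "\<lambda>y. \<not> x \<le> y"] IH
    by (auto simp: less_Suc_eq_le Max_ge_iff)
  moreover have "?v \<le> N" using dig_less[of N] by (intro evf_le) (simp add: less_Suc_eq_le)
  ultimately show ?case using Exists.prems
    by (subst T) (simp_all add: step_def sum_less_indicator del: sum.lessThan_Suc evf.simps)
qed (subst T; simp add: step_def del: sum.lessThan_Suc)+

text \<open>A number with a valid tag that codes no formula has a malformed component, whose entry
  is 0 by induction, and each clause of \<open>step\<close> propagates that 0.\<close>

lemma table_not_code: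
  assumes T: "\<And>a e. a < k \<Longrightarrow> e < Suc N ^ k \<Longrightarrow> T a e = step N k T a e"
    and "a \<notin> range code" "a < k" "e < Suc N ^ k"
  shows "T a e = 0"
  using assms(2-4)
proof (induction a arbitrary: e rule: less_induct)
  case (less a)
  define t r x y where "t = pfst a" and "r = psnd a" and "x = pfst r" and "y = psnd r"
  have a: "a = prod_encode (t, r)" and r: "r = prod_encode (x, y)"
    by (simp_all add: t_def r_def x_def y_def prod_encode_pfst_psnd)
  have neq: "a \<noteq> code A" for A using less.prems(1) by blast
  have "t \<noteq> 0" using neq[of "PVar r"] a by auto
  then have lt: "r < a" "x < a" "y < a"
    using psnd_less[of a] pfst_le[of r] psnd_le[of r] by (simp_all add: t_def r_def x_def y_def)
  have IH: "T b e' = 0" if "b < a" "b \<notin> range code" "e' < Suc N ^ k" for b e'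
    using less.IH[OF that(1,2)] that less.prems(2) by simp
  have "T a e = step N k T a e" using T less.prems by simp
  also have "\<dots> = 0"
  proof -
    consider "t = 1" | "t = 2" | "t = 3" | "t = 4" | "t = 5" | "t = 6" | "t = 7" | "t = 8" | "t > 8"
      using \<open>t \<noteq> 0\<close> by linarith
    then show ?thesis
    proof cases
      case 1
      then have "r \<noteq> 0" using neq[of Bot] a by auto
      with 1 show ?thesis by (simp add: step_def a)
    next
      case 2
      then have "r \<noteq> 0" using neq[of Top] a by auto
      with 2 show ?thesis by (simp add: step_def a)
    next
      case 3
      then have "x \<notin> range code \<or> y \<notin> range code" using neq[of "And _ _"] a r by auto
      with 3 show ?thesis using IH lt less.prems by (auto simp: step_def a r)
    next
      case 4
      then have "x \<notin> range code \<or> y \<notin> range code" using neq[of "Or _ _"] a r by auto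
      with 4 show ?thesis using IH lt less.prems by (auto simp: step_def a r)
    next
      case 5
      then have "x \<notin> range code \<or> y \<notin> range code" using neq[of "Imp _ _"] a r by auto
      with 5 show ?thesis using IH lt less.prems by (auto simp: step_def a r)
    next
      case 6
      then have "r \<notin> range code" using neq[of "Circ _"] a by auto
      with 6 show ?thesis using IH lt less.prems by (auto simp: step_def a)
    next
      case 7
      then have "y \<notin> range code" using neq[of "Forall x _"] a r by auto
      then have "T y e' = 0" if "e' < Suc N ^ k" for e' using IH lt(3) that by blast
      \<comment> \<open>This provides an instance at which the universal condition fails.\<close>
      moreover have "variant N k x e e" by (simp add: variant_def)
      ultimately show ?thesis using 7 less.prems(3)
        by (auto simp: step_def a r simp del: sum.lessThan_Suc)
    next
      case 8
      then have "y \<notin> range code" using neq[of "Exists x _"] a r by auto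
      then have "T y e' = 0" if "e' < Suc N ^ k" for e' using IH lt(3) that by blast
      then show ?thesis using 8
        by (auto simp: step_def a r simp del: sum.lessThan_Suc)
    next
      case 9
      then show ?thesis by (simp add: step_def a)
    qed
  qed
  finally show ?case .
qed

section \<open>The decision procedure\<close>

definition chain_size :: "nat \<Rightarrow> nat" where
  "chain_size c = 2 ^ (Suc c + 4 ^ c)"

definition decision :: "nat \<Rightarrow> bool" where
  "decision c \<longleftrightarrow> (\<forall>e<Suc (chain_size c) ^ Suc c.
     lookup (chain_size c) (Suc c)
       (truth_table (chain_size c) (Suc c) (Suc c * Suc (chain_size c) ^ Suc c)) c e =
     Suc (chain_size c))"

lemma rf_chain_size [rf_intros]: "rf n f \<Longrightarrow> rf n (\<lambda>xs. chain_size (f xs))"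
  unfolding chain_size_def by (intro rf_intros)

lemma rp_decision: "rp 1 (\<lambda>xs. decision (xs ! 0))"
  unfolding decision_def by (intro rf_intros) simp_all

lemma decision_iff: "decision c \<longleftrightarrow> c \<in> code ` G_qp_up"
proof -
  define N where "N = chain_size c"
  define T where "T = lookup N (Suc c) (truth_table N (Suc c) (Suc c * Suc N ^ Suc c))"
  have T: "T a e = step N (Suc c) T a e" if "a < Suc c" "e < Suc N ^ Suc c" for a e
    unfolding T_def using that by (rule lookup_truth_table)
  have decision: "decision c \<longleftrightarrow> (\<forall>e<Suc N ^ Suc c. T c e = Suc N)"
    by (simp only: decision_def T_def N_def)
  show ?thesis
  proof (cases "c \<in> range code")
    case True
    then obtain A where A: "c = code A" by blast
    have fv: "fv A \<subseteq> {..<Suc c}" using fv_le_code A by (auto simp: less_Suc_eq_le)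
    have "T c e = Suc (evf N (dig (Suc N) e) A)" if "e < Suc N ^ Suc c" for e
      using table_code[OF T, of A e] that A by simp
    then have "decision c \<longleftrightarrow> (\<forall>e<Suc N ^ Suc c. evf N (dig (Suc N) e) A = N)"
      by (simp add: decision)
    also have "\<dots> \<longleftrightarrow> valid_chain N A"
    proof
      assume *: "\<forall>e<Suc N ^ Suc c. evf N (dig (Suc N) e) A = N"
      show "valid_chain N A" unfolding valid_chain_def
      proof (intro allI impI)
        fix \<rho> :: "nat \<Rightarrow> nat" assume "\<forall>p. \<rho> p \<le> N"
        then obtain e where e: "e < Suc N ^ Suc c" "\<forall>p<Suc c. dig (Suc N) e p = \<rho> p"
          using ex_dig by blast
        have "evf N \<rho> A = evf N (dig (Suc N) e) A"
          by (rule evf_cong) (use e(2) fv in auto)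
        then show "evf N \<rho> A = N" using * e(1) by simp
      qed
    next
      assume "valid_chain N A"
      then show "\<forall>e<Suc N ^ Suc c. evf N (dig (Suc N) e) A = N"
        using dig_less[of N] by (simp add: valid_chain_def less_Suc_eq_le)
    qed
    also have "\<dots> \<longleftrightarrow> tautology V_up A"
    proof (rule tautology_V_up_iff_valid_chain[OF fv, symmetric])
      \<comment> \<open>In the exponent of \<open>chain_size\<close>, \<open>Suc c\<close> bounds
        the number of variables and \<open>4 ^ c\<close> the rank.\<close>
      show "2 ^ (Suc c + rank A) \<le> N"
        using rank_le[of A] by (simp add: N_def chain_size_def A power_increasing del: code.simps)
    qed
    also have "\<dots> \<longleftrightarrow> c \<in> code ` G_qp_up"
      by (auto simp: A G_qp_up_def code_inject)
    finally show ?thesis .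
  next
    case False
    \<comment> \<open>Acceptance would need \<open>Suc N\<close> in every column, so column 0
      already refutes it.\<close>
    then have "T c 0 = 0" using table_not_code[OF T] by simp
    then have "\<not> decision c" unfolding decision by force
    with False show ?thesis by blast
  qed
qed

theorem theorem5: "decidable G_qp_up"
proof -
  obtain f where f: "recfn 1 f" "\<And>xs. length xs = 1 \<Longrightarrow> (if decision (xs ! 0) then 1 else 0) = f xs"
    using rp_decision unfolding rp_def rf_def by blast
  have "f [x] = (if x \<in> code ` G_qp_up then 1 else 0)" for x
    using f(2)[of "[x]"] by (simp add: decision_iff)
  with f(1) show ?thesis unfolding decidable_def recursive_set_def by blast
qed

end
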